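(* Let $n\ge2$ and suppose that $A$ is a maximal (abelian $\mathbb{T}$-invariant $*$-subalgebra) of the Cuntz algebra $\mathcal{O}_n$ with respect to the standard circle action. Then $A\subset\mathcal{O}_n^0$.
   Context: $\mathcal{O}_n=C^*(s_1,\dots,s_n)$ is the Cuntz algebra, generated by isometries with $\sum_i s_is_i^*=1$. The standard circle action is $\omega:\mathbb{T}\to\mathrm{Aut}(\mathcal{O}_n)$, $\omega_t(s_i)=ts_i$, and $\mathcal{O}_n^0=\{x:\omega_t(x)=x\ \forall t\}$. A $*$-subalgebra $A$ is $\mathbb{T}$-invariant if $\omega_t(A)\subset A$ for all $t\in\mathbb{T}$; a maximal (abelian $\mathbb{T}$-invariant $*$-subalgebra) is one that is maximal under inclusion among abelian $\mathbb{T}$-invariant $*$-subalgebras of $\mathcal{O}_n$. *)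

theory Defs
  imports "HOL-Analysis.Analysis"
begin

definition cstar_alg :: "(complex \<Rightarrow> 'a::{real_normed_algebra_1,banach} \<Rightarrow> 'a) \<Rightarrow> ('a \<Rightarrow> 'a) \<Rightarrow> bool" where
  "cstar_alg sm st \<longleftrightarrow>
     (\<forall>r x. sm (complex_of_real r) x = r *\<^sub>R x) \<and>
     (\<forall>a b x. sm (a + b) x = sm a x + sm b x) \<and>
     (\<forall>a x y. sm a (x + y) = sm a x + sm a y) \<and>
     (\<forall>a b x. sm (a * b) x = sm a (sm b x)) \<and>
     (\<forall>a x y. sm a (x * y) = sm a x * y \<and> sm a (x * y) = x * sm a y) \<and>
     (\<forall>a x. norm (sm a x) = cmod a * norm x) \<and>
     (\<forall>x y. st (x + y) = st x + st y) \<and>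
     (\<forall>a x. st (sm a x) = sm (cnj a) (st x)) \<and>
     (\<forall>x y. st (x * y) = st y * st x) \<and>
     (\<forall>x. st (st x) = x) \<and>
     (\<forall>x. norm (st x * x) = (norm x)\<^sup>2)"

text \<open>*-subalgebras (not necessarily closed, not necessarily unital).\<close>
definition star_subalg :: "(complex \<Rightarrow> 'a::{real_normed_algebra_1,banach} \<Rightarrow> 'a) \<Rightarrow> ('a \<Rightarrow> 'a) \<Rightarrow> 'a set \<Rightarrow> bool" where
  "star_subalg sm st A \<longleftrightarrow>
     0 \<in> A \<and> (\<forall>x\<in>A. \<forall>y\<in>A. x + y \<in> A \<and> x * y \<in> A) \<and>
     (\<forall>a. \<forall>x\<in>A. sm a x \<in> A) \<and> (\<forall>x\<in>A. st x \<in> A)"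

definition gen_star_subalg :: "(complex \<Rightarrow> 'a::{real_normed_algebra_1,banach} \<Rightarrow> 'a) \<Rightarrow> ('a \<Rightarrow> 'a) \<Rightarrow> 'a set \<Rightarrow> 'a set" where
  "gen_star_subalg sm st S = \<Inter>{A. star_subalg sm st A \<and> S \<subseteq> A}"

text \<open>The C*-algebra is the Cuntz algebra O_n with generators s 0, ..., s (n-1)
  (by Cuntz's uniqueness theorem every such C*-algebra is isomorphic to O_n).\<close>
definition is_cuntz :: "(complex \<Rightarrow> 'a::{real_normed_algebra_1,banach} \<Rightarrow> 'a) \<Rightarrow> ('a \<Rightarrow> 'a) \<Rightarrow> nat \<Rightarrow> (nat \<Rightarrow> 'a) \<Rightarrow> bool" where
  "is_cuntz sm st n s \<longleftrightarrow>
     cstar_alg sm st \<and>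
     (\<forall>i<n. st (s i) * s i = 1) \<and>
     (\<Sum>i<n. s i * st (s i)) = 1 \<and>
     closure (gen_star_subalg sm st (s ` {..<n})) = UNIV"

definition std_circle_action :: "(complex \<Rightarrow> 'a::{real_normed_algebra_1,banach} \<Rightarrow> 'a) \<Rightarrow> ('a \<Rightarrow> 'a) \<Rightarrow> nat \<Rightarrow> (nat \<Rightarrow> 'a) \<Rightarrow> (complex \<Rightarrow> 'a \<Rightarrow> 'a) \<Rightarrow> bool" where
  "std_circle_action sm st n s \<omega> \<longleftrightarrow>
     (\<forall>t. cmod t = 1 \<longrightarrow>
        bij (\<omega> t) \<and>
        (\<forall>x y. \<omega> t (x + y) = \<omega> t x + \<omega> t y) \<and>
        (\<forall>x y. \<omega> t (x * y) = \<omega> t x * \<omega> t y) \<and>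
        (\<forall>a x. \<omega> t (sm a x) = sm a (\<omega> t x)) \<and>
        (\<forall>x. \<omega> t (st x) = st (\<omega> t x)) \<and>
        (\<forall>i<n. \<omega> t (s i) = sm t (s i)))"

definition T_invariant :: "(complex \<Rightarrow> 'a \<Rightarrow> 'a) \<Rightarrow> 'a set \<Rightarrow> bool" where
  "T_invariant \<omega> A \<longleftrightarrow> (\<forall>t. cmod t = 1 \<longrightarrow> \<omega> t ` A \<subseteq> A)"

definition abelian_set :: "'a::times set \<Rightarrow> bool" where
  "abelian_set A \<longleftrightarrow> (\<forall>x\<in>A. \<forall>y\<in>A. x * y = y * x)"

definition fixed_alg :: "(complex \<Rightarrow> 'a \<Rightarrow> 'a) \<Rightarrow> 'a set" where
  "fixed_alg \<omega> = {x. \<forall>t. cmod t = 1 \<longrightarrow> \<omega> t x = x}"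

definition abelian_T_inv_subalg where
  "abelian_T_inv_subalg sm st \<omega> A \<longleftrightarrow> star_subalg sm st A \<and> abelian_set A \<and> T_invariant \<omega> A"

definition maximal_abelian_T_inv :: "(complex \<Rightarrow> 'a::{real_normed_algebra_1,banach} \<Rightarrow> 'a) \<Rightarrow> ('a \<Rightarrow> 'a) \<Rightarrow> (complex \<Rightarrow> 'a \<Rightarrow> 'a) \<Rightarrow> 'a set \<Rightarrow> bool" where
  "maximal_abelian_T_inv sm st \<omega> A \<longleftrightarrow>
     abelian_T_inv_subalg sm st \<omega> A \<and>
     (\<forall>B. abelian_T_inv_subalg sm st \<omega> B \<and> A \<subseteq> B \<longrightarrow> B = A)"

end

theory Submission
  imports Defs
begin

text \<open>
  Average the inner compressions: \<open>Psi x = (1/n) (\<Sum>i<n. s\<^sub>i\<^sup>* x s\<^sub>i)\<close>. Its iterates converge in norm to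
  scalars, \<open>Psi\<^sup>m x \<longlonglongrightarrow> \<phi>(x) 1\<close>, and from \<open>Psi (s\<^sub>j y) = (1/n) y s\<^sub>j\<close> one reads off the KMS
  condition \<open>\<phi>(y x) = n\<^sup>d \<phi>(x y)\<close> for \<open>x\<close> of degree \<open>d\<close>. If such an \<open>x\<close> is normal and
  \<open>d \<noteq> 0\<close>, then \<open>\<phi>(x\<^sup>* x) = n\<^sup>d \<phi>(x\<^sup>* x)\<close> forces \<open>\<phi>(x\<^sup>* x) = 0\<close>, and \<open>x = 0\<close> because \<open>\<phi>\<close> is
  faithful on homogeneous elements. The Fourier coefficients of an element of \<open>A\<close> lie in the
  closure of \<open>A\<close>, hence are normal, so only the one of degree \<open>0\<close> survives.
\<close>

section \<open>Elementary C*-algebra theory\<close>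

text \<open>The action consists of bare *-automorphisms, with no continuity in \<open>t\<close>.
  Integrals over the circle are therefore avoided: contractivity of *-homomorphisms is derived from
  the axioms, with Banach fixed points supplying the square roots and inverses that replace spectral
  theory, and Fourier coefficients are limits of finite averages over roots of unity. These averages
  are eventually constant on homogeneous elements and extend by density. The obstacle to
  faithfulness is that it must reach the closures of the homogeneous spaces, whose elements have no
  finite expansion in words. There \<open>y\<close> is approximated by a block element
  \<open>c\<close>, whose norm is tested on vectors \<open>v\<close> in \<open>blk q 0\<close>; for
  these \<open>st (c * v) * (c * v)\<close> is a scalar, on which \<phi> loses nothing.\<close>

locale cstar_algebra =
  fixes sm :: "complex \<Rightarrow> 'a::{real_normed_algebra_1,banach} \<Rightarrow> 'a" and st :: "'a \<Rightarrow> 'a"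
  assumes cstar: "cstar_alg sm st"
begin

text \<open>Turns the scalar action into multiplication by central elements, so that the ring laws
  cover it.\<close>

definition scal :: "complex \<Rightarrow> 'a" where "scal c = sm c 1"

lemma sm_conv_scal: "sm c x = scal c * x"
  using cstar unfolding cstar_alg_def scal_def by (metis mult_1)

lemma scal_commute: "x * scal c = scal c * x"
  using cstar unfolding cstar_alg_def scal_def by (metis mult_1 mult.right_neutral)

lemma scal_left_commute: "x * (scal c * y) = scal c * (x * y)"
  by (metis mult.assoc scal_commute)

lemma scal_add: "scal (a + b) = scal a + scal b"
  using cstar unfolding cstar_alg_def scal_def by simp

lemma scal_mult: "scal (a * b) = scal a * scal b"
  using cstar unfolding cstar_alg_def by (metis scal_def sm_conv_scal)

lemma scal_of_real: "scal (complex_of_real r) = of_real r"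
  using cstar unfolding cstar_alg_def scal_def by (simp add: of_real_def)

lemma scal_0 [simp]: "scal 0 = 0" and scal_1 [simp]: "scal 1 = 1"
  using scal_of_real[of 0] scal_of_real[of 1] by simp_all

lemma norm_scal [simp]: "norm (scal c) = cmod c"
  using cstar unfolding cstar_alg_def scal_def by (metis mult.right_neutral norm_one)

lemma norm_scal_mult [simp]: "norm (scal c * x) = cmod c * norm x"
  using cstar unfolding cstar_alg_def by (metis sm_conv_scal)

lemma scal_minus: "scal (- a) = - scal a"
  by (metis add.right_inverse add_eq_0_iff scal_0 scal_add)

lemma scal_diff: "scal (a - b) = scal a - scal b"
  by (metis diff_conv_add_uminus scal_add scal_minus)

lemma scal_sum: "scal (sum f I) = (\<Sum>i\<in>I. scal (f i))"
  by (induction I rule: infinite_finite_induct) (auto simp: scal_add)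

lemma scal_eq_iff [simp]: "scal a = scal b \<longleftrightarrow> a = b"
  by (metis norm_scal norm_eq_zero right_minus_eq scal_diff)

lemma scaleR_conv_scal: "r *\<^sub>R x = scal (complex_of_real r) * x"
  by (simp add: scal_of_real scaleR_conv_of_real)

lemma bounded_linear_scal: "bounded_linear scal"
proof (rule bounded_linear_intro[where K=1])
  show "scal (r *\<^sub>R x) = r *\<^sub>R scal x" for r x
    by (simp add: scaleR_conv_of_real scal_mult scal_of_real)
qed (auto simp: scal_add)

lemmas tendsto_scal [tendsto_intros] = bounded_linear.tendsto[OF bounded_linear_scal]

lemma st_add: "st (x + y) = st x + st y"
  using cstar unfolding cstar_alg_def by blast

lemma st_mult: "st (x * y) = st y * st x"
  using cstar unfolding cstar_alg_def by blast

lemma st_st [simp]: "st (st x) = x"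
  using cstar unfolding cstar_alg_def by blast

lemma norm_st_mult: "norm (st x * x) = (norm x)\<^sup>2"
  using cstar unfolding cstar_alg_def by blast

lemma st_1 [simp]: "st 1 = 1"
  by (metis mult.left_neutral mult.right_neutral st_mult st_st)

lemma st_scal: "st (scal c) = scal (cnj c)"
  using cstar unfolding cstar_alg_def scal_def by (metis st_1)

lemma st_of_real [simp]: "st (of_real r) = of_real r"
  by (metis scal_of_real st_scal complex_cnj_complex_of_real)

lemma st_0 [simp]: "st 0 = 0"
  by (metis of_real_0 st_of_real)

lemma st_minus: "st (- x) = - st x"
  by (metis add.right_inverse add_eq_0_iff st_0 st_add)

lemma st_diff: "st (x - y) = st x - st y"
  by (metis diff_conv_add_uminus st_add st_minus)

lemma st_sum: "st (sum f I) = (\<Sum>i\<in>I. st (f i))"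
  by (induction I rule: infinite_finite_induct) (auto simp: st_add)

lemma st_power: "st (x ^ k) = st x ^ k"
  by (induction k) (auto simp: st_mult power_commutes)

lemma norm_st [simp]: "norm (st x) = norm x"
proof -
  have le: "norm y \<le> norm (st y)" for y
  proof (cases "y = 0")
    case False
    have "norm y * norm y \<le> norm (st y) * norm y"
      using norm_mult_ineq[of "st y" y] by (simp add: norm_st_mult power2_eq_square)
    then show ?thesis using False by simp
  qed simp
  show ?thesis using le[of x] le[of "st x"] by simp
qed

lemma st_scaleR [simp]: "st (r *\<^sub>R x) = r *\<^sub>R st x"
  by (metis scaleR_conv_of_real st_mult st_of_real scal_of_real scal_commute)

lemma bounded_linear_st: "bounded_linear st"
  by (rule bounded_linear_intro[where K=1]) (auto simp: st_add)

lemmas tendsto_st [tendsto_intros] = bounded_linear.tendsto[OF bounded_linear_st]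

lemma norm_self_adjoint_square: "st h = h \<Longrightarrow> norm (h * h) = (norm h)\<^sup>2"
  by (metis norm_st_mult)

text \<open>Plays the part of the spectral radius formula: the norm of a self-adjoint element can be
  read off from bounds on its dyadic powers.\<close>

lemma norm_self_adjoint_power: "st h = h \<Longrightarrow> norm (h ^ (2 ^ i)) = norm h ^ (2 ^ i)"
proof (induction i)
  case (Suc i)
  have "norm (h ^ (2 ^ i) * h ^ (2 ^ i)) = (norm (h ^ (2 ^ i)))\<^sup>2"
    by (rule norm_self_adjoint_square) (simp add: st_power Suc.prems)
  then show ?case
    using Suc by (simp add: mult_2 power_add power2_eq_square)
qed simp

text \<open>\<open>k\<close> is the real part of \<open>u = k + \<i> q\<close>, and \<open>u\<^sup>* u = k\<^sup>2 + q\<^sup>2\<close>.\<close>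
lemma norm_le_sum_squares:
  assumes "st k = k" "st q = q" "k * q = q * k"
  shows "(norm k)\<^sup>2 \<le> norm (k * k + q * q)"
proof -
  define u where "u = k + scal \<i> * q"
  have su: "st u = k - scal \<i> * q"
    by (simp add: u_def st_add st_mult st_scal assms scal_minus scal_commute)
  have ii: "scal \<i> * (scal \<i> * x) = - x" for x
    using scal_mult[of \<i> \<i>] scal_minus[of 1]
    by (metis i_squared mult.assoc mult_minus1 scal_1)
  have "st u * u = k * k + q * q"
    unfolding su unfolding u_def
    by (simp add: algebra_simps ii scal_left_commute[of k] scal_left_commute[of q] assms(3))
  then have nu: "(norm u)\<^sup>2 = norm (k * k + q * q)"
    by (metis norm_st_mult)
  have "u + st u = 2 *\<^sub>R k"
    unfolding su by (simp add: u_def scaleR_2)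
  then have "2 * norm k \<le> 2 * norm u"
    using norm_triangle_ineq[of u "st u"] by simp
  then show ?thesis
    by (simp add: nu[symmetric])
qed

text \<open>With \<open>g = 1 - r\<close> the equation becomes \<open>r = (h + r * r) / 2\<close>, a
  fixed point problem that is contractive with constant \<open>norm h\<close> on the ball of that
  radius. Self-adjointness and commutation with everything commuting with \<open>h\<close> are
  closed conditions, so they are built into the domain \<open>X\<close> and inherited by the fixed
  point.\<close>

lemma self_adjoint_sqrt:
  assumes h: "st h = h" "norm h < 1"
  obtains g where "st g = g" "g * g = 1 - h" "\<And>z. z * h = h * z \<Longrightarrow> z * g = g * z"
proof -
  define X where "X = {r. norm r \<le> norm h} \<inter> {r. st r = r} \<inter> (\<Inter>z\<in>{z. z * h = h * z}. {r. z * r = r * z})"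
  define f where "f r = (1/2) *\<^sub>R (h + r * r)" for r
  have "closed X"
    unfolding X_def
    by (intro closed_Int closed_INT ballI closed_Collect_le closed_Collect_eq continuous_intros
        bounded_linear.continuous_on[OF bounded_linear_st])
  then have "complete X" by (simp add: complete_eq_closed)
  moreover have "X \<noteq> {}" by (auto simp: X_def set_eq_iff intro!: exI[of _ 0])
  moreover have "f ` X \<subseteq> X"
  proof (rule image_subsetI)
    fix r assume "r \<in> X"
    then have r: "norm r \<le> norm h" "st r = r" "\<And>z. z * h = h * z \<Longrightarrow> z * r = r * z"
      by (auto simp: X_def)
    have "norm (r * r) \<le> norm h * 1"
      using r h by (intro order_trans[OF norm_mult_ineq] mult_mono) auto
    then have "norm (f r) \<le> norm h"
      using norm_triangle_ineq[of h "r * r"] by (simp add: f_def)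
    moreover have "st (f r) = f r"
      by (simp add: f_def st_add st_mult r(2) h(1))
    moreover have "z * f r = f r * z" if "z * h = h * z" for z
    proof -
      have "z * r = r * z" using r(3) that .
      then have "z * (r * r) = (r * r) * z" by (metis mult.assoc)
      then show ?thesis using that by (simp add: f_def algebra_simps)
    qed
    ultimately show "f r \<in> X" by (simp add: X_def)
  qed
  moreover have "dist (f x) (f y) \<le> norm h * dist x y" if "x \<in> X" "y \<in> X" for x y
  proof -
    have "f x - f y = (1/2) *\<^sub>R (x * (x - y) + (x - y) * y)"
      by (simp add: f_def algebra_simps)
    moreover have "norm (x * (x - y)) \<le> norm h * norm (x - y)" "norm ((x - y) * y) \<le> norm h * norm (x - y)"
      using that norm_mult_ineq[of x "x - y"] norm_mult_ineq[of "x - y" y]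
        mult_right_mono[of "norm x" "norm h" "norm (x - y)"]
        mult_right_mono[of "norm y" "norm h" "norm (x - y)"]
      by (simp_all add: X_def mult.commute)
    ultimately show ?thesis
      using norm_triangle_ineq[of "x * (x - y)" "(x - y) * y"] by (simp add: dist_norm)
  qed
  ultimately obtain r where r: "r \<in> X" "f r = r"
    using Banach_fix[of X "norm h" f, OF _ _ norm_ge_zero h(2)] by blast
  have "h + r * r = r + r"
    using arg_cong[OF r(2), of "\<lambda>x. 2 *\<^sub>R x"] by (simp add: f_def scaleR_2)
  then have "(1 - r) * (1 - r) = 1 - h"
    by (simp add: algebra_simps)
  moreover have "st (1 - r) = 1 - r" using r by (simp add: st_diff X_def)
  moreover have "z * (1 - r) = (1 - r) * z" if "z * h = h * z" for z
    using r that by (simp add: X_def algebra_simps)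
  ultimately show ?thesis using that by blast
qed

section \<open>Invertibility as a substitute for the spectrum\<close>

definition invertible_elt :: "'a \<Rightarrow> bool" where
  "invertible_elt x \<longleftrightarrow> (\<exists>b. b * x = 1 \<and> x * b = 1)"

lemma invertible_elt_mult:
  assumes "invertible_elt x" "invertible_elt y"
  shows "invertible_elt (x * y)"
proof -
  obtain a b where "a * x = 1" "x * a = 1" "b * y = 1" "y * b = 1"
    using assms by (auto simp: invertible_elt_def)
  then have "(b * a) * (x * y) = 1" "(x * y) * (b * a) = 1"
    by (metis mult.assoc mult.right_neutral)+
  then show ?thesis by (auto simp: invertible_elt_def)
qed

lemma invertible_elt_of_real: "r \<noteq> 0 \<Longrightarrow> invertible_elt (of_real r)"
  unfolding invertible_elt_def by (rule exI[of _ "of_real (inverse r)"]) (simp flip: of_real_mult)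

text \<open>Fixed points of \<open>y \<mapsto> 1 + x * y\<close> and
  \<open>y \<mapsto> 1 + y * x\<close> are a right and a left inverse, which then coincide; this
  takes the place of the Neumann series.\<close>

lemma invertible_one_minus:
  assumes "norm x < 1"
  shows "invertible_elt (1 - x)"
proof -
  have "\<exists>!y. 1 + x * y = y"
    using assms by (intro banach_fix_type[of "norm x"])
      (auto simp: dist_norm norm_mult_ineq simp flip: right_diff_distrib)
  moreover have "\<exists>!y. 1 + y * x = y"
    using assms by (intro banach_fix_type[of "norm x"])
      (auto simp: dist_norm norm_mult_ineq mult.commute[of "norm x"] simp flip: left_diff_distrib)
  ultimately obtain y z where yz: "1 + x * y = y" "1 + z * x = z" by blast
  have a: "(1 - x) * y = 1" "z * (1 - x) = 1" using yz by (auto simp: algebra_simps)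
  then have "z = y" by (metis mult.assoc mult_1 mult.right_neutral)
  then show ?thesis using a by (auto simp: invertible_elt_def)
qed

lemma invertible_of_real_minus:
  assumes "norm x < r"
  shows "invertible_elt (of_real r - x)"
proof -
  have r: "r > 0" using assms norm_ge_zero[of x] by linarith
  have "of_real r - x = of_real r * (1 - (1 / r) *\<^sub>R x)"
    using r by (simp add: algebra_simps scaleR_conv_of_real flip: of_real_mult)
       (simp add: mult.assoc[symmetric] flip: of_real_mult)
  moreover have "norm ((1 / r) *\<^sub>R x) < 1" using assms r by simp
  ultimately show ?thesis
    using r by (simp add: invertible_elt_mult invertible_elt_of_real invertible_one_minus)
qed

text \<open>If \<open>1 - k\<^sup>2\<close> has the inverse \<open>b\<close> and \<open>\<epsilon>\<close> is small, then
  \<open>1 - \<epsilon> - k\<^sup>2 = (1 - k\<^sup>2) (1 - \<epsilon> b)\<close> is nearly a square \<open>q\<^sup>2\<close>,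
  so that \<open>1 = \<parallel>k\<parallel>\<^sup>2 \<le> \<parallel>k\<^sup>2 + q\<^sup>2\<parallel>\<close> is nearly \<open>1 - \<epsilon>\<close>.\<close>
lemma not_invertible_one_minus_square:
  assumes k: "st k = k" "norm k = 1"
  shows "\<not> invertible_elt (1 - k * k)"
proof
  assume "invertible_elt (1 - k * k)"
  then obtain b where b: "b * (1 - k * k) = 1" "(1 - k * k) * b = 1"
    by (auto simp: invertible_elt_def)
  have sb: "st b = b"
  proof -
    have "st b * (1 - k * k) = 1"
      using arg_cong[OF b(2), of st] by (simp add: st_mult st_diff k)
    then show ?thesis by (metis b(2) mult.assoc mult_1 mult.right_neutral)
  qed
  have kb: "k * b = b * k"
  proof -
    have "k * b = b * (1 - k * k) * (k * b)" by (simp add: b)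
    also have "\<dots> = b * k * ((1 - k * k) * b)" by (simp add: algebra_simps)
    finally show ?thesis by (simp add: b)
  qed
  have bkk: "b * (k * k) = k * (k * b)"
    by (metis kb mult.assoc)
  define e where "e = 1 / (2 * (1 + norm b))"
  have e: "e > 0" "e < 1" and eb: "e * norm b < 1"
    using norm_ge_zero[of b] by (auto simp: e_def divide_simps add_pos_nonneg intro: add_strict_increasing2)
  \<comment> \<open>Scaling \<open>k * k\<close> by \<open>t < 1\<close> gives norm below one, as
    \<open>self_adjoint_sqrt\<close> demands. The defect \<open>e / 4\<close> costs at most
    \<open>(e / 4) * 2\<close> in the final estimate, less than the gain \<open>e\<close>.\<close>
  define t where "t = 1 - e / 4"
  have t: "0 < t" "t < 1" using e by (auto simp: t_def)
  have kk: "norm (k * k) = 1" using norm_self_adjoint_square[OF k(1)] k by simp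
  obtain g1 where g1: "st g1 = g1" "g1 * g1 = 1 - t *\<^sub>R (k * k)"
     "\<And>z. z * (t *\<^sub>R (k * k)) = t *\<^sub>R (k * k) * z \<Longrightarrow> z * g1 = g1 * z"
  proof -
    have "st (t *\<^sub>R (k * k)) = t *\<^sub>R (k * k)" "norm (t *\<^sub>R (k * k)) < 1"
      using t k by (simp_all add: kk st_mult)
    then show thesis by (rule self_adjoint_sqrt) (rule that)
  qed
  obtain g2 where g2: "st g2 = g2" "g2 * g2 = 1 - e *\<^sub>R b"
     "\<And>z. z * (e *\<^sub>R b) = e *\<^sub>R b * z \<Longrightarrow> z * g2 = g2 * z"
  proof -
    have "st (e *\<^sub>R b) = e *\<^sub>R b" "norm (e *\<^sub>R b) < 1"
      using e eb sb by simp_all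
    then show thesis by (rule self_adjoint_sqrt) (rule that)
  qed
  have c1: "k * g1 = g1 * k" "b * g1 = g1 * b"
    using g1(3)[of k] g1(3)[of b] bkk by (simp_all add: mult.assoc)
  have c2: "k * g2 = g2 * k" "g1 * g2 = g2 * g1"
    using g2(3)[of k] g2(3)[of g1] by (simp_all add: kb c1)
  define q where "q = g1 * g2"
  have "st q = q" by (simp add: q_def st_mult g1 g2 c2)
  moreover have "k * q = q * k" by (metis q_def c1(1) c2(1) mult.assoc)
  ultimately have "1 \<le> norm (k * k + q * q)"
    using norm_le_sum_squares[of k q] k by simp
  also have "q * q = (1 - t *\<^sub>R (k * k)) * (1 - e *\<^sub>R b)"
    unfolding q_def g1(2)[symmetric] g2(2)[symmetric] by (metis c2(2) mult.assoc)
  also have "k * k + \<dots> = (1 - e) *\<^sub>R 1 + (e / 4) *\<^sub>R (k * k * (1 - e *\<^sub>R b))"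
  proof -
    have "(1 - k * k) * (1 - e *\<^sub>R b) = 1 - k * k - e *\<^sub>R 1"
      by (simp only: right_diff_distrib mult.right_neutral mult_scaleR_right b(2))
    moreover have "(1 - t *\<^sub>R (k * k)) * (1 - e *\<^sub>R b) = (1 - k * k) * (1 - e *\<^sub>R b) + (e/4) *\<^sub>R (k * k * (1 - e *\<^sub>R b))"
      by (simp add: t_def algebra_simps)
    ultimately show ?thesis by (simp add: algebra_simps)
  qed
  also have "norm \<dots> \<le> (1 - e) + (e / 4) * 2"
  proof (intro norm_triangle_mono)
    have "norm (k * k * (1 - e *\<^sub>R b)) \<le> 1 * norm (1 - e *\<^sub>R b)"
      using norm_mult_ineq[of "k * k"] kk by metis
    also have "norm (1 - e *\<^sub>R b) \<le> 2"
      using norm_triangle_ineq4[of 1 "e *\<^sub>R b"] e eb by simp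
    finally show "norm ((e/4) *\<^sub>R (k * k * (1 - e *\<^sub>R b))) \<le> e / 4 * 2" using e by simp
  qed (use e in simp)
  finally show False using e by simp
qed

text \<open>After rescaling to norm one, \<open>1 - h * h\<close> is the product of the two elements
  up to a positive factor, so they cannot both be invertible. In spectral terms,
  \<open>norm k\<close> or \<open>- norm k\<close> belongs to the spectrum of
  \<open>k\<close>.\<close>

lemma not_invertible_norm_pm:
  assumes k: "st k = k" "k \<noteq> 0"
    and i: "invertible_elt (of_real (norm k) - k)" "invertible_elt (of_real (norm k) + k)"
  shows False
proof -
  define r where "r = norm k"
  have r: "r > 0" using k by (simp add: r_def)
  define h where "h = (1 / r) *\<^sub>R k"
  have h: "st h = h" "norm h = 1"
    using k r by (auto simp: h_def r_def)
  have rh: "r *\<^sub>R h = k" using r by (simp add: h_def)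
  have "1 - h * h = of_real (1 / r) * of_real (1 / r) * ((of_real r - k) * (of_real r + k))"
    unfolding rh[symmetric] using r by (simp add: of_real_def algebra_simps)
  then have "invertible_elt (1 - h * h)"
    using r i by (auto intro!: invertible_elt_mult invertible_elt_of_real simp: r_def simp flip: of_real_mult)
  then show False using not_invertible_one_minus_square h by blast
qed

text \<open>A unital homomorphism preserves invertibility, hence cannot enlarge spectra, and the
  norm of the self-adjoint element \<open>st x * x\<close> is visible in its spectrum. This gives
  the continuity of each \<open>\<omega> t\<close>.\<close>

lemma star_hom_contractive:
  assumes one: "\<pi> 1 = 1" and add: "\<And>x y. \<pi> (x + y) = \<pi> x + \<pi> y"
    and mult: "\<And>x y. \<pi> (x * y) = \<pi> x * \<pi> y" and scale: "\<And>c x. \<pi> (scal c * x) = scal c * \<pi> x"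
    and st: "\<And>x. \<pi> (st x) = st (\<pi> x)"
  shows "norm (\<pi> x) \<le> norm x"
proof -
  define h where "h = st x * x"
  define r where "r = norm (\<pi> h)"
  have sh: "st (\<pi> h) = \<pi> h" by (simp add: h_def st[symmetric] st_mult)
  have inv: "invertible_elt (\<pi> y)" if "invertible_elt y" for y
    using that one mult unfolding invertible_elt_def by metis
  have real: "\<pi> (of_real c) = of_real c" for c
    by (metis mult.right_neutral one scal_of_real scale)
  have minus: "\<pi> (- y) = - \<pi> y" for y
    using scale[of "-1" y] by (simp add: scal_minus)
  have "r \<le> norm h"
  proof (rule ccontr)
    assume "\<not> r \<le> norm h"
    then have "norm h < r" "norm (- h) < r" by auto
    from this[THEN invertible_of_real_minus, THEN inv]
    have "invertible_elt (of_real r - \<pi> h)" "invertible_elt (of_real r + \<pi> h)"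
      using add[of "of_real r" "- h"] by (auto simp: add real minus)
    moreover have "\<pi> h \<noteq> 0" using \<open>\<not> r \<le> norm h\<close> by (auto simp: r_def)
    ultimately show False
      using not_invertible_norm_pm[OF sh] by (auto simp: r_def)
  qed
  then have "(norm (\<pi> x))\<^sup>2 \<le> (norm x)\<^sup>2"
    by (simp add: r_def h_def mult st norm_st_mult)
  then show ?thesis by simp
qed

end

text \<open>Mirrors the recursion of \<open>blk\<close>: left letters are stripped first, right
  letters only when no left ones remain.\<close>

lemma nat_pair_induct:
  assumes "P 0 0" "\<And>q. P 0 q \<Longrightarrow> P 0 (Suc q)" "\<And>p q. P p q \<Longrightarrow> P (Suc p) q"
  shows "P p q"
  using assms by (induction p arbitrary: q) (rule nat_induct, auto)

section \<open>The algebra generated by the isometries and its grading\<close>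

locale cuntz = cstar_algebra sm st
  for sm :: "complex \<Rightarrow> 'a::{real_normed_algebra_1,banach} \<Rightarrow> 'a" and st :: "'a \<Rightarrow> 'a" +
  fixes n :: nat and s :: "nat \<Rightarrow> 'a"
  assumes n2: "n \<ge> 2" and cuntz: "is_cuntz sm st n s"
begin

section \<open>Relations between the generating isometries\<close>

lemma isometry: "i < n \<Longrightarrow> st (s i) * s i = 1"
  using cuntz by (simp add: is_cuntz_def)

lemma sum_range_projections: "(\<Sum>i<n. s i * st (s i)) = 1"
  using cuntz by (simp add: is_cuntz_def)

lemma norm_isometry_mult: "i < n \<Longrightarrow> norm (s i * x) = norm x"
proof -
  assume i: "i < n"
  have "st (s i * x) * (s i * x) = st x * x"
    by (metis i isometry mult.assoc mult_1 st_mult)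
  then have "(norm (s i * x))\<^sup>2 = (norm x)\<^sup>2"
    by (metis norm_st_mult)
  then show ?thesis by simp
qed

lemma norm_isometry: "i < n \<Longrightarrow> norm (s i) = 1"
  using norm_isometry_mult[of i 1] by simp

lemma expand_left: "x = (\<Sum>i<n. s i * (st (s i) * x))"
  by (simp add: sum_range_projections flip: mult.assoc sum_distrib_right)

lemma expand_right: "x = (\<Sum>i<n. x * s i * st (s i))"
  by (simp add: mult.assoc sum_range_projections flip: sum_distrib_left)

text \<open>The elements \<open>s\<^sub>i\<^sup>* (1 - s\<^sub>j s\<^sub>j\<^sup>*) s\<^sub>i\<close> with \<open>j \<noteq> i\<close> are contractions with average \<open>1\<close>;
  since \<open>1\<close> is an extreme point of the unit ball, each of them is \<open>1\<close>.\<close>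
lemma orthogonal_isometries:
  assumes "i < n" "l < n" "l \<noteq> i"
  shows "st (s l) * s i = 0"
proof -
  define a where "a j = st (s i) * (s j * st (s j)) * s i" for j
  define J where "J = {..<n} - {i} - {l}"
  have sa: "st (a j) = a j" for j by (simp add: a_def st_mult mult.assoc)
  have ai: "a i = 1"
    using isometry[OF assms(1)] by (simp add: a_def mult.assoc)
  have "(\<Sum>j<n. a j) = st (s i) * (\<Sum>j<n. s j * st (s j)) * s i"
    by (simp only: a_def sum_distrib_left sum_distrib_right)
  then have "(\<Sum>j<n. a j) = 1"
    by (simp add: sum_range_projections isometry assms)
  then have "a i + (a l + (\<Sum>j\<in>J. a j)) = 1"
    using assms sum.remove[of "{..<n}" i a] sum.remove[of "{..<n} - {i}" l a]
    by (simp add: J_def)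
  then have sumJ: "a l = - (\<Sum>j\<in>J. a j)" by (simp add: ai eq_neg_iff_add_eq_0)
  have le1: "norm (1 - a j) \<le> 1" if "j < n" for j
  proof -
    define e where "e = 1 - s j * st (s j)"
    have "s j * st (s j) * (s j * st (s j)) = s j * st (s j)"
      by (metis isometry mult.assoc mult_1 that)
    then have "e * e = e" by (simp add: e_def algebra_simps)
    moreover have "st e = e" by (simp add: e_def st_diff st_mult)
    ultimately have "(norm e)\<^sup>2 = norm e" using norm_self_adjoint_square[of e] by simp
    then have "norm e \<le> 1" by (auto simp: power2_eq_square)
    have "1 - a j = st (s i) * (e * s i)"
      using assms by (simp add: a_def e_def right_diff_distrib left_diff_distrib mult.assoc isometry)
    also have "norm \<dots> \<le> norm (st (s i)) * (norm e * norm (s i))"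
      by (intro order_trans[OF norm_mult_ineq] mult_left_mono norm_mult_ineq norm_ge_zero)
    finally show ?thesis using \<open>norm e \<le> 1\<close> assms by (simp add: norm_isometry)
  qed
  have "of_nat (card J) + a l = (\<Sum>j\<in>J. 1 - a j)"
    by (simp add: sumJ sum_subtractf)
  also have "norm \<dots> \<le> of_nat (card J)"
    using sum_norm_le[of J "\<lambda>j. 1 - a j" "\<lambda>_. 1"] le1 by (auto simp: J_def)
  finally have leJ: "norm (of_nat (card J) + a l) \<le> card J" .
  have "a l = 0"
  proof (rule ccontr)
    assume nz: "a l \<noteq> 0"
    let ?r = "norm (a l)"
    have r: "?r > 0" using nz by simp
    \<comment> \<open>The shifts by \<open>card J\<close> and by \<open>1\<close> cancel, leaving
      \<open>?r - a l\<close> here and \<open>?r + a l\<close> next: the two norm bounds exclude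
      both signs from the spectrum of \<open>a l\<close>.\<close>
    have "invertible_elt (of_real (card J + ?r) - (of_nat (card J) + a l))"
      by (rule invertible_of_real_minus) (use leJ r in linarith)
    moreover have "invertible_elt (of_real (1 + ?r) - (1 - a l))"
      by (rule invertible_of_real_minus) (use le1[OF assms(2)] r in linarith)
    ultimately show False
      using not_invertible_norm_pm[OF sa nz] by (simp add: algebra_simps)
  qed
  then have "st (st (s l) * s i) * (st (s l) * s i) = 0"
    by (simp add: a_def st_mult mult.assoc)
  then show ?thesis using norm_st_mult[of "st (s l) * s i"] by simp
qed

lemma isometry_products: "i < n \<Longrightarrow> j < n \<Longrightarrow> st (s i) * s j = (if i = j then 1 else 0)"
  using isometry orthogonal_isometries by auto

lemma isometry_products_left: "i < n \<Longrightarrow> j < n \<Longrightarrow> st (s i) * (s j * x) = (if i = j then x else 0)"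
  by (simp add: isometry_products flip: mult.assoc)

text \<open>\<open>blk p q\<close> is the span of the elements \<open>s\<^sub>\<mu> s\<^sub>\<nu>\<^sup>*\<close> with words \<open>\<mu>\<close>, \<open>\<nu>\<close> of lengths
  \<open>p\<close>, \<open>q\<close>, described by the condition that all \<open>s\<^sub>\<mu>\<^sup>* x s\<^sub>\<nu>\<close> are scalars.\<close>
primrec blk :: "nat \<Rightarrow> nat \<Rightarrow> 'a set" where
  "blk 0 = rec_nat (range scal) (\<lambda>q B. {x. \<forall>i<n. x * s i \<in> B})"
| "blk (Suc p) = (\<lambda>q. {x. \<forall>i<n. st (s i) * x \<in> blk p q})"

lemma blk_simps [simp]:
  "blk 0 0 = range scal"
  "blk 0 (Suc q) = {x. \<forall>i<n. x * s i \<in> blk 0 q}"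
  "blk (Suc p) q = {x. \<forall>i<n. st (s i) * x \<in> blk p q}"
  by simp_all

declare blk.simps [simp del]

text \<open>Restores the left-right symmetry that the recursion breaks.\<close>

lemma blk_Suc_right: "x \<in> blk p (Suc q) \<longleftrightarrow> (\<forall>i<n. x * s i \<in> blk p q)"
  by (induction p arbitrary: x) (auto simp: mult.assoc)

lemma blk_0: "0 \<in> blk p q"
  by (induction p q rule: nat_pair_induct) (auto intro: range_eqI[of _ _ 0])

lemma blk_add: "x \<in> blk p q \<Longrightarrow> y \<in> blk p q \<Longrightarrow> x + y \<in> blk p q"
  by (induction p q arbitrary: x y rule: nat_pair_induct)
     (auto simp: distrib_left distrib_right simp flip: scal_add)

lemma blk_scal: "x \<in> blk p q \<Longrightarrow> scal c * x \<in> blk p q"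
  by (induction p q arbitrary: x rule: nat_pair_induct)
     (auto simp: scal_left_commute mult.assoc simp flip: scal_mult)

lemma blk_sum: "(\<And>i. i \<in> I \<Longrightarrow> f i \<in> blk p q) \<Longrightarrow> sum f I \<in> blk p q"
  by (induction I rule: infinite_finite_induct) (auto intro: blk_0 blk_add)

lemma blk_st: "x \<in> blk p q \<Longrightarrow> st x \<in> blk q p"
proof (induction p q arbitrary: x rule: nat_pair_induct)
  case 1
  then show ?case by (auto simp: st_scal)
next
  case (2 q)
  then have "st (x * s i) \<in> blk q 0" if "i < n" for i using that by auto
  then show ?case by (simp add: st_mult)
next
  case (3 p q)
  then have "st (st (s i) * x) \<in> blk q p" if "i < n" for i using that by auto
  then show ?case by (simp add: st_mult blk_Suc_right)
qed

text \<open>The reason why blocks with the same \<open>p - q\<close> are nested: stability under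
  compression by one letter on each side is exactly membership in the block with both lengths raised
  by one.\<close>

lemma blk_compress:
  "x \<in> blk p q \<Longrightarrow> i < n \<Longrightarrow> j < n \<Longrightarrow> st (s i) * x * s j \<in> blk p q"
proof (induction p q arbitrary: x i j rule: nat_pair_induct)
  case 1
  then obtain c where "x = scal c" by auto
  then have "st (s i) * x * s j = scal (if i = j then c else 0)"
    using 1 by (simp add: scal_commute mult.assoc isometry_products)
  then show ?case by simp
next
  case (2 q)
  have "st (s i) * (x * s j) * s k \<in> blk 0 q" if "k < n" for k
    using 2 that by simp
  then show ?case by (simp add: mult.assoc)
next
  case (3 p q)
  have "st (s k) * (st (s i) * x * s j) \<in> blk p q" if "k < n" for k
  proof -
    have "st (s k) * (st (s i) * x) * s j \<in> blk p q"
      using 3 that by simp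
    then show ?thesis by (simp add: mult.assoc)
  qed
  then show ?case by simp
qed

lemma blk_Suc_Suc: "x \<in> blk p q \<Longrightarrow> x \<in> blk (Suc p) (Suc q)"
  using blk_compress by (simp add: blk_Suc_right)

lemma blk_raise: "x \<in> blk p q \<Longrightarrow> x \<in> blk (p + k) (q + k)"
  by (induction k) (simp_all only: add_0_right add_Suc_right blk_Suc_Suc)

lemma blk_mult: "x \<in> blk p q \<Longrightarrow> y \<in> blk q r \<Longrightarrow> x * y \<in> blk p r"
proof (induction p q arbitrary: x y rule: nat_pair_induct)
  case 1
  then show ?case by (auto intro: blk_scal)
next
  case (2 q)
  have "x * y = (\<Sum>i<n. (x * s i) * (st (s i) * y))"
    by (subst expand_left[of y]) (simp add: sum_distrib_left mult.assoc)
  then show ?case using 2 by (auto intro!: blk_sum)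
next
  case (3 p q)
  then show ?case by (simp flip: mult.assoc)
qed

lemma blk_isometry_mult: "x \<in> blk p q \<Longrightarrow> i < n \<Longrightarrow> s i * x \<in> blk (Suc p) q"
  by (simp add: isometry_products_left blk_0)

lemma isometry_in_blk: "i < n \<Longrightarrow> s i \<in> blk (Suc 0) 0"
  using blk_isometry_mult[of 1 0 0 i] by (force intro: range_eqI[of _ _ 1])

text \<open>Makes \<open>blk p 0\<close> a Hilbert space under \<open>st x * y\<close>; by the
  C*-identity its Hilbert norm is the norm of the algebra.\<close>

lemma blk_inner: "x \<in> blk p 0 \<Longrightarrow> y \<in> blk p 0 \<Longrightarrow> \<exists>c. st x * y = scal c"
  using blk_mult[OF blk_st, of x p 0 y 0] by auto

text \<open>The algebraic spectral subspace of degree \<open>d\<close>. The lengths may vary because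
  a sum or product of two elements is formed in a common larger block, reached by
  \<open>blk_raise\<close>.\<close>

definition grade :: "int \<Rightarrow> 'a set" where
  "grade d = {x. \<exists>p q. x \<in> blk p q \<and> int p - int q = d}"

lemma gradeI: "x \<in> blk p q \<Longrightarrow> int p - int q = d \<Longrightarrow> x \<in> grade d"
  by (auto simp: grade_def)

lemma grade_add:
  assumes "x \<in> grade d" "y \<in> grade d"
  shows "x + y \<in> grade d"
proof -
  obtain p q p' q' where *: "x \<in> blk p q" "y \<in> blk p' q'" "int p - int q = d" "int p' - int q' = d"
    using assms by (auto simp: grade_def)
  moreover have "q' + p = q + p'" using * by linarith
  ultimately have "x \<in> blk (p + p') (q + p')" "y \<in> blk (p + p') (q + p')"
    using blk_raise[of x p q p'] blk_raise[of y p' q' p] by (simp_all add: add.commute)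
  then show ?thesis using *(3) by (intro gradeI[OF blk_add]) (assumption | simp)+
qed

lemma grade_mult:
  assumes "x \<in> grade d" "y \<in> grade e"
  shows "x * y \<in> grade (d + e)"
proof -
  obtain p q p' q' where *: "x \<in> blk p q" "y \<in> blk p' q'" "int p - int q = d" "int p' - int q' = e"
    using assms by (auto simp: grade_def)
  then have "x \<in> blk (p + p') (q + p')" "y \<in> blk (q + p') (q' + q)"
    using blk_raise[of x p q p'] blk_raise[of y p' q' q] by (simp_all add: add.commute)
  then show ?thesis using * by (intro gradeI[OF blk_mult]) auto
qed

lemma grade_0: "0 \<in> grade d"
  by (rule gradeI[of _ "nat d" "nat (- d)"]) (auto simp: blk_0)

lemma grade_scal: "x \<in> grade d \<Longrightarrow> scal c * x \<in> grade d"
  by (auto simp: grade_def intro: blk_scal)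

lemma grade_st: "x \<in> grade d \<Longrightarrow> st x \<in> grade (- d)"
  using blk_st by (fastforce simp: grade_def)

section \<open>The dense *-subalgebra of polynomials\<close>

inductive_set poly :: "'a set" where
  poly_grade: "x \<in> grade d \<Longrightarrow> x \<in> poly"
| poly_add: "x \<in> poly \<Longrightarrow> y \<in> poly \<Longrightarrow> x + y \<in> poly"

lemma poly_mult:
  assumes "x \<in> poly" "y \<in> poly"
  shows "x * y \<in> poly"
  using assms(1)
proof (induction x)
  case (poly_grade x d)
  show ?case
    using assms(2)
    by (induction y) (auto simp: distrib_left intro: poly.intros grade_mult[OF poly_grade.hyps])
qed (auto simp: distrib_right intro: poly.intros)

lemma poly_scal: "x \<in> poly \<Longrightarrow> scal c * x \<in> poly"
proof (induction x rule: poly.induct)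
  case (poly_grade x d)
  show ?case by (rule poly.poly_grade[OF grade_scal[OF poly_grade]])
next
  case (poly_add x y)
  then show ?case by (simp add: distrib_left poly.poly_add)
qed

lemma poly_st: "x \<in> poly \<Longrightarrow> st x \<in> poly"
proof (induction x rule: poly.induct)
  case (poly_grade x d)
  show ?case by (rule poly.poly_grade[OF grade_st[OF poly_grade]])
next
  case (poly_add x y)
  then show ?case by (simp add: st_add poly.poly_add)
qed

lemma star_subalg_poly: "star_subalg sm st poly"
  by (simp add: star_subalg_def sm_conv_scal poly_grade[OF grade_0] poly_add poly_mult poly_scal poly_st)

lemma poly_dense: "e > 0 \<Longrightarrow> \<exists>p\<in>poly. norm (x - p) < e"
proof -
  assume "e > 0"
  have "s ` {..<n} \<subseteq> poly"
    using isometry_in_blk by (auto intro!: poly_grade[of _ 1] gradeI[of _ "Suc 0" 0] simp del: blk_simps)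
  then have "gen_star_subalg sm st (s ` {..<n}) \<subseteq> poly"
    unfolding gen_star_subalg_def using star_subalg_poly by (intro Inter_lower) auto
  then have "x \<in> closure poly"
    using cuntz closure_mono unfolding is_cuntz_def by blast
  then show ?thesis
    using \<open>e > 0\<close> by (metis closure_approachable dist_commute dist_norm)
qed

end

section \<open>The KMS functional\<close>

lemma sum_nonneg_Reals: "(\<And>i. i \<in> I \<Longrightarrow> f i \<in> \<real>\<^sub>\<ge>\<^sub>0) \<Longrightarrow> sum f I \<in> \<real>\<^sub>\<ge>\<^sub>0"
  by (induction I rule: infinite_finite_induct) auto

text \<open>The three-epsilon argument, serving both the iterates of \<open>Psi\<close> and the
  Fourier averages.\<close>

lemma contractions_convergent:
  fixes T :: "nat \<Rightarrow> 'a::real_normed_vector \<Rightarrow> 'b::banach"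
  assumes diff: "\<And>m x y. T m (x - y) = T m x - T m y" and contr: "\<And>m x. norm (T m x) \<le> norm x"
    and dense: "\<And>e. e > 0 \<Longrightarrow> \<exists>y. norm (x - y) < e \<and> convergent (\<lambda>m. T m y)"
  shows "convergent (\<lambda>m. T m x)"
proof (rule Cauchy_convergent, rule CauchyI)
  fix e :: real assume "e > 0"
  then obtain y where y: "norm (x - y) < e / 3" "convergent (\<lambda>m. T m y)"
    using dense[of "e / 3"] by auto
  then have "Cauchy (\<lambda>m. T m y)" by (intro convergent_Cauchy)
  then obtain M where M: "\<And>m k. m \<ge> M \<Longrightarrow> k \<ge> M \<Longrightarrow> norm (T m y - T k y) < e / 3"
    using CauchyD[of "\<lambda>m. T m y" "e / 3"] \<open>e > 0\<close> by auto
  have "norm (T m x - T k x) < e" if "m \<ge> M" "k \<ge> M" for m k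
  proof -
    have "T m x - T k x = T m (x - y) + (T m y - T k y) - T k (x - y)"
      by (simp add: diff)
    also have "norm \<dots> \<le> norm (T m (x - y)) + norm (T m y - T k y) + norm (T k (x - y))"
      by (intro order_trans[OF norm_triangle_ineq4] add_mono norm_triangle_ineq order_refl)
    finally show ?thesis
      using contr[of m "x - y"] contr[of k "x - y"] M[OF that] y(1) by linarith
  qed
  then show "\<exists>M. \<forall>m\<ge>M. \<forall>k\<ge>M. norm (T m x - T k x) < e" by blast
qed

context cuntz
begin

text \<open>On \<open>blk m m\<close>, a copy of the full matrix algebra of size \<open>n\<^sup>m\<close>, the \<open>m\<close>-th power of this
  contraction is the normalised trace.\<close>
definition Psi :: "'a \<Rightarrow> 'a" where
  "Psi x = (1 / real n) *\<^sub>R (\<Sum>i<n. st (s i) * x * s i)"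

lemma Psi_add: "Psi (x + y) = Psi x + Psi y"
  by (simp add: Psi_def distrib_left distrib_right sum.distrib scaleR_add_right)

lemma Psi_scal_mult: "Psi (scal c * x) = scal c * Psi x"
  by (simp add: Psi_def sum_distrib_left scal_left_commute mult.assoc)

lemma Psi_scal: "Psi (scal c) = scal c"
proof -
  have "(\<Sum>i<n. st (s i) * scal c * s i) = (\<Sum>i<n. scal c)"
    by (intro sum.cong) (simp_all add: scal_commute mult.assoc isometry)
  then show ?thesis using n2 by (simp add: Psi_def sum_constant_scaleR del: sum_constant)
qed

lemma Psi_st: "Psi (st x) = st (Psi x)"
  by (simp add: Psi_def st_sum st_mult mult.assoc)

lemma norm_Psi: "norm (Psi x) \<le> norm x"
proof -
  have "norm (st (s i) * x * s i) \<le> norm x" if "i < n" for i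
  proof -
    have "norm (st (s i) * x * s i) \<le> norm (st (s i)) * norm x * norm (s i)"
      by (intro order_trans[OF norm_mult_ineq] mult_right_mono norm_mult_ineq norm_ge_zero)
    then show ?thesis using that by (simp add: norm_isometry)
  qed
  then have "norm (\<Sum>i<n. st (s i) * x * s i) \<le> (\<Sum>i<n. norm x)"
    by (intro sum_norm_le) auto
  then show ?thesis using n2 by (simp add: Psi_def divide_simps mult.commute)
qed

lemma Psi_funpow_add: "(Psi ^^ m) (x + y) = (Psi ^^ m) x + (Psi ^^ m) y"
  by (induction m) (simp_all add: Psi_add)

lemma Psi_funpow_scal_mult: "(Psi ^^ m) (scal c * x) = scal c * (Psi ^^ m) x"
  by (induction m) (simp_all add: Psi_scal_mult)

lemma Psi_funpow_diff: "(Psi ^^ m) (x - y) = (Psi ^^ m) x - (Psi ^^ m) y"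
  by (metis Psi_funpow_add add_diff_cancel_right' diff_add_cancel)

lemma Psi_funpow_scal: "(Psi ^^ m) (scal c) = scal c"
  by (induction m) (simp_all add: Psi_scal)

lemma Psi_funpow_st: "(Psi ^^ m) (st x) = st ((Psi ^^ m) x)"
  by (induction m) (simp_all add: Psi_st)

lemma norm_Psi_funpow: "norm ((Psi ^^ m) x) \<le> norm x"
  by (induction m) (auto intro: order_trans[OF norm_Psi])

section \<open>Convergence of the iterates to scalars\<close>

definition converges_to_scal :: "'a \<Rightarrow> complex \<Rightarrow> bool" where
  "converges_to_scal x c \<longleftrightarrow> (\<lambda>m. (Psi ^^ m) x) \<longlonglongrightarrow> scal c"

lemma converges_to_scal_Psi: "converges_to_scal (Psi x) c \<longleftrightarrow> converges_to_scal x c"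
  unfolding converges_to_scal_def
  by (simp flip: funpow_swap1 filterlim_sequentially_Suc[of "\<lambda>m. (Psi ^^ m) x"])

lemma converges_to_scal_unique: "converges_to_scal x c \<Longrightarrow> converges_to_scal x d \<Longrightarrow> c = d"
  unfolding converges_to_scal_def using LIMSEQ_unique scal_eq_iff by blast

lemma converges_to_scal_add:
  "converges_to_scal x c \<Longrightarrow> converges_to_scal y d \<Longrightarrow> converges_to_scal (x + y) (c + d)"
  unfolding converges_to_scal_def Psi_funpow_add scal_add by (rule tendsto_add)

lemma converges_to_scal_scal: "converges_to_scal (scal c) c"
  by (simp add: converges_to_scal_def Psi_funpow_scal)

lemma converges_to_scal_scal_mult:
  "converges_to_scal x c \<Longrightarrow> converges_to_scal (scal a * x) (a * c)"
  unfolding converges_to_scal_def Psi_funpow_scal_mult scal_mult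
  by (rule tendsto_mult_left)

lemma converges_to_scal_st: "converges_to_scal x c \<Longrightarrow> converges_to_scal (st x) (cnj c)"
  unfolding converges_to_scal_def Psi_funpow_st st_scal[symmetric] by (rule tendsto_st)

text \<open>On \<open>blk (Suc p) 0\<close> the map \<open>n Psi\<close> is a cyclic shift of words, an isometry.\<close>
lemma Psi_analytic:
  assumes x: "x \<in> blk (Suc p) 0"
  shows "Psi x \<in> blk (Suc p) 0 \<and> norm (Psi x) = norm x / n"
proof -
  define z where "z i = st (s i) * x" for i
  define y where "y = (\<Sum>i<n. z i * s i)"
  have z: "z i \<in> blk p 0" if "i < n" for i using x that by (simp add: z_def)
  have "y \<in> blk (Suc p) 0"
    unfolding y_def
    by (intro blk_sum blk_mult[of _ _ "Suc 0"] blk_Suc_Suc z isometry_in_blk) auto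
  have "st y * y = (\<Sum>i<n. \<Sum>j<n. st (s i) * (st (z i) * z j) * s j)"
    by (simp add: y_def st_sum st_mult sum_product mult.assoc)
  also have "\<dots> = (\<Sum>i<n. \<Sum>j<n. if i = j then st (z i) * z i else 0)"
  proof (intro sum.cong refl)
    \<comment> \<open>\<open>st (z i) * z j\<close> is a scalar, hence central; it moves aside and
      lets the outer isometries meet, which kills the terms with
      \<open>i \<noteq> j\<close>.\<close>
    fix i j assume ij: "i \<in> {..<n}" "j \<in> {..<n}"
    then obtain c where "st (z i) * z j = scal c" using blk_inner z by blast
    then show "st (s i) * (st (z i) * z j) * s j = (if i = j then st (z i) * z i else 0)"
      using ij by (auto simp: scal_commute mult.assoc isometry_products)
  qed
  also have "\<dots> = (\<Sum>i<n. st x * (s i * (st (s i) * x)))"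
    by (simp add: z_def st_mult mult.assoc)
  also have "\<dots> = st x * x"
    using expand_left[of x] by (simp flip: sum_distrib_left)
  finally have "(norm y)\<^sup>2 = (norm x)\<^sup>2" by (metis norm_st_mult)
  then have "norm y = norm x" by simp
  moreover have "Psi x = scal (of_real (1 / n)) * y"
    by (simp add: Psi_def y_def z_def scaleR_conv_scal)
  ultimately show ?thesis
    using blk_scal[OF \<open>y \<in> blk (Suc p) 0\<close>] by (simp add: norm_divide del: blk_simps)
qed

lemma converges_to_scal_analytic:
  assumes "x \<in> blk (Suc p) 0"
  shows "converges_to_scal x 0"
proof -
  have "(Psi ^^ m) x \<in> blk (Suc p) 0 \<and> norm ((Psi ^^ m) x) = norm x * (1 / n) ^ m" for m
    by (induction m) (use assms Psi_analytic[of _ p] in \<open>simp_all del: blk_simps add: field_simps\<close>)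
  moreover have "(\<lambda>m. norm x * (1 / n) ^ m) \<longlonglongrightarrow> norm x * 0"
    using n2 by (intro tendsto_mult_left LIMSEQ_power_zero) simp
  ultimately have "(\<lambda>m. norm ((Psi ^^ m) x)) \<longlonglongrightarrow> 0" by simp
  then show ?thesis
    unfolding converges_to_scal_def scal_0 by (rule tendsto_norm_zero_cancel)
qed

text \<open>\<open>Psi\<close> strips one letter from each side. When one side is empty, what
  remains is a scalar, an element of some \<open>blk (Suc p) 0\<close>, or the adjoint of such an
  element; the last two die out geometrically.\<close>

lemma blk_converges_to_scal: "x \<in> blk p q \<Longrightarrow> \<exists>c. converges_to_scal x c"
proof (induction p arbitrary: q x)
  case 0
  show ?case
  proof (cases q)
    case 0
    then show ?thesis using \<open>x \<in> blk 0 q\<close> converges_to_scal_scal by auto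
  next
    case (Suc q')
    then have "st x \<in> blk (Suc q') 0" using blk_st[OF \<open>x \<in> blk 0 q\<close>] by (simp only:)
    from converges_to_scal_st[OF converges_to_scal_analytic[OF this]] show ?thesis by auto
  qed
next
  case (Suc p)
  show ?case
  proof (cases q)
    case 0
    then show ?thesis using Suc.prems converges_to_scal_analytic by blast
  next
    case (Suc q')
    have "st (s i) * x * s i \<in> blk p q'" if "i < n" for i
      using Suc.prems that unfolding Suc by (simp add: blk_Suc_right)
    then have "Psi x \<in> blk p q'"
      unfolding Psi_def scaleR_conv_scal by (intro blk_scal blk_sum) auto
    then show ?thesis using Suc.IH converges_to_scal_Psi by blast
  qed
qed

lemma poly_converges_to_scal: "x \<in> poly \<Longrightarrow> \<exists>c. converges_to_scal x c"
proof (induction x rule: poly.induct)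
  case (poly_grade x d)
  then show ?case using blk_converges_to_scal by (auto simp: grade_def simp del: blk_simps)
next
  case (poly_add x y)
  then show ?case using converges_to_scal_add by blast
qed

lemma ex_converges_to_scal: "\<exists>c. converges_to_scal x c"
proof -
  have near: "\<exists>y c. norm (x - y) < e \<and> converges_to_scal y c" if "e > 0" for e
    using poly_dense[OF that, of x] poly_converges_to_scal by blast
  have "convergent (\<lambda>m. (Psi ^^ m) x)"
    by (rule contractions_convergent)
      (use near in \<open>auto simp: Psi_funpow_diff norm_Psi_funpow converges_to_scal_def convergent_def, blast\<close>)
  then obtain L where L: "(\<lambda>m. (Psi ^^ m) x) \<longlonglongrightarrow> L"
    using convergentD by blast
  \<comment> \<open>The scalars are an isometric copy of the complex plane, hence closed, and the
    limits belonging to nearby polynomials approximate \<open>L\<close>.\<close>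
  have "closed (range scal)"
    using complete_isometric_image[OF zero_less_one subspace_UNIV bounded_linear_scal]
    by (simp add: complete_imp_closed complete_UNIV)
  moreover have "L \<in> closure (range scal)"
    unfolding closure_approachable
  proof (intro allI impI)
    fix e :: real assume "e > 0"
    then obtain y c where y: "norm (x - y) < e" "(\<lambda>m. (Psi ^^ m) y) \<longlonglongrightarrow> scal c"
      using near unfolding converges_to_scal_def by blast
    have "(\<lambda>m. norm ((Psi ^^ m) (x - y))) \<longlonglongrightarrow> norm (L - scal c)"
      unfolding Psi_funpow_diff by (intro tendsto_norm tendsto_diff L y)
    then have "norm (L - scal c) \<le> norm (x - y)"
      by (rule LIMSEQ_le_const2) (use norm_Psi_funpow in blast)
    then show "\<exists>z\<in>range scal. dist z L < e"
      using y(1) by (intro bexI[of _ "scal c"]) (simp_all add: dist_norm norm_minus_commute)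
  qed
  ultimately show ?thesis using L unfolding converges_to_scal_def by auto
qed

text \<open>The KMS state of the circle action, obtained without first constructing a conditional
  expectation onto the fixed-point algebra.\<close>

definition phi :: "'a \<Rightarrow> complex" where "phi x = (THE c. converges_to_scal x c)"

lemma converges_to_scal_phi: "converges_to_scal x (phi x)"
  unfolding phi_def using ex_converges_to_scal[of x] converges_to_scal_unique
  by (metis theI)

lemma phi_eqI: "converges_to_scal x c \<Longrightarrow> phi x = c"
  using converges_to_scal_phi converges_to_scal_unique by blast

lemma phi_add: "phi (x + y) = phi x + phi y"
  by (intro phi_eqI converges_to_scal_add converges_to_scal_phi)

lemma phi_scal_mult: "phi (scal c * x) = c * phi x"
  by (intro phi_eqI converges_to_scal_scal_mult converges_to_scal_phi)

lemma phi_scal [simp]: "phi (scal c) = c"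
  by (intro phi_eqI converges_to_scal_scal)

lemma phi_Psi: "phi (Psi x) = phi x"
  by (intro phi_eqI) (simp add: converges_to_scal_Psi converges_to_scal_phi)

lemma norm_phi: "cmod (phi x) \<le> norm x"
proof -
  have "(\<lambda>m. norm ((Psi ^^ m) x)) \<longlonglongrightarrow> norm (scal (phi x))"
    using converges_to_scal_phi[of x] unfolding converges_to_scal_def by (rule tendsto_norm)
  then have "norm (scal (phi x)) \<le> norm x"
    by (rule LIMSEQ_le_const2) (use norm_Psi_funpow in blast)
  then show ?thesis by simp
qed

lemma phi_0 [simp]: "phi 0 = 0"
  using phi_scal[of 0] by simp

lemma phi_diff: "phi (x - y) = phi x - phi y"
  by (metis phi_add add_diff_cancel_right' diff_add_cancel)

lemma phi_sum: "phi (sum f I) = (\<Sum>i\<in>I. phi (f i))"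
  by (induction I rule: infinite_finite_induct) (auto simp: phi_add)

lemma bounded_linear_phi: "bounded_linear phi"
proof (rule bounded_linear_intro[where K=1])
  show "phi (r *\<^sub>R x) = r *\<^sub>R phi x" for r x
    by (simp add: scaleR_conv_scal phi_scal_mult scaleR_conv_of_real)
qed (auto simp: phi_add norm_phi)

lemmas tendsto_phi [tendsto_intros] = bounded_linear.tendsto[OF bounded_linear_phi]

lemma phi_eq_average: "n * phi x = (\<Sum>i<n. phi (st (s i) * x * s i))"
proof -
  have "phi x = (\<Sum>i<n. phi (st (s i) * x * s i)) / n"
    by (subst phi_Psi[symmetric]) (simp add: Psi_def scaleR_conv_scal phi_scal_mult phi_sum)
  then show ?thesis using n2 by simp
qed

text \<open>The KMS condition for one generator: in the average expressing
  \<open>Psi\<close>-invariance, orthogonality leaves only the summand \<open>j = i\<close>.\<close>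

lemma phi_isometry_mult:
  assumes "i < n"
  shows "n * phi (s i * x) = phi (x * s i)"
proof -
  have "(\<Sum>j<n. phi (st (s j) * (s i * x) * s j)) = (\<Sum>j<n. if j = i then phi (x * s i) else 0)"
    using assms by (intro sum.cong) (auto simp: isometry_products_left)
  then show ?thesis using assms by (simp add: phi_eq_average)
qed

lemma phi_mult_st_isometry:
  assumes "i < n"
  shows "n * phi (x * st (s i)) = phi (st (s i) * x)"
proof -
  have "(\<Sum>j<n. phi (st (s j) * (x * st (s i)) * s j)) = (\<Sum>j<n. if j = i then phi (st (s i) * x) else 0)"
    using assms by (intro sum.cong) (auto simp: isometry_products mult.assoc)
  then show ?thesis using assms by (simp add: phi_eq_average)
qed

text \<open>The letters of \<open>x\<close> are carried around the product one at a time, each at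
  the cost of a factor \<open>n\<close>: left letters on one side of the equation, right letters on
  the other. Stated without division, so that only natural powers occur.\<close>

lemma blk_kms: "x \<in> blk p q \<Longrightarrow> n ^ p * phi (x * y) = n ^ q * phi (y * x)"
proof (induction p q arbitrary: x y rule: nat_pair_induct)
  case 1
  then show ?case by (auto simp: scal_commute)
next
  case (2 q)
  have IH: "phi (x * s i * z) = n ^ q * phi (z * (x * s i))" if "i < n" for i z
    using 2 that by simp
  have "phi (x * y) = (\<Sum>i<n. phi (x * s i * (st (s i) * y)))"
    by (subst expand_right[of x]) (simp add: sum_distrib_right mult.assoc phi_sum)
  also have "\<dots> = (\<Sum>i<n. n ^ q * phi (st (s i) * (y * (x * s i))))"
    by (intro sum.cong refl) (metis IH lessThan_iff mult.assoc)
  also have "\<dots> = (\<Sum>i<n. n ^ Suc q * phi (y * (x * s i * st (s i))))"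
  proof (intro sum.cong refl)
    fix i assume "i \<in> {..<n}"
    then show "n ^ q * phi (st (s i) * (y * (x * s i))) = n ^ Suc q * phi (y * (x * s i * st (s i)))"
      using phi_mult_st_isometry[of i "y * (x * s i)"] by (simp add: mult.assoc)
  qed
  also have "\<dots> = n ^ Suc q * phi (y * x)"
    by (subst (2) expand_right[of x]) (simp add: sum_distrib_left phi_sum)
  finally show ?case by simp
next
  case (3 p q)
  have IH: "n ^ p * phi (st (s i) * x * z) = n ^ q * phi (z * (st (s i) * x))" if "i < n" for i z
    using 3 that by simp
  have "phi (x * y) = (\<Sum>i<n. phi (s i * (st (s i) * x * y)))"
    by (subst expand_left[of x]) (simp add: sum_distrib_right mult.assoc phi_sum)
  then have "n ^ Suc p * phi (x * y) = (\<Sum>i<n. n ^ p * (n * phi (s i * (st (s i) * x * y))))"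
    by (simp only: sum_distrib_left power_Suc2 mult.assoc of_nat_mult of_nat_power)
  also have "\<dots> = (\<Sum>i<n. n ^ p * phi (st (s i) * x * (y * s i)))"
  proof (intro sum.cong refl)
    fix i assume "i \<in> {..<n}"
    then show "n ^ p * (n * phi (s i * (st (s i) * x * y))) = n ^ p * phi (st (s i) * x * (y * s i))"
      using phi_isometry_mult[of i "st (s i) * x * y"] by (simp add: mult.assoc)
  qed
  also have "\<dots> = (\<Sum>i<n. n ^ q * phi (y * (s i * (st (s i) * x))))"
    by (intro sum.cong refl) (metis IH lessThan_iff mult.assoc)
  also have "\<dots> = n ^ q * phi (y * x)"
    by (subst (2) expand_left[of x]) (simp add: sum_distrib_left phi_sum)
  finally show ?case .
qed

definition cgrade :: "int \<Rightarrow> 'a set" where "cgrade d = closure (grade d)"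

lemma grade_imp_cgrade: "x \<in> grade d \<Longrightarrow> x \<in> cgrade d"
  using closure_subset by (auto simp: cgrade_def)

lemma cgradeI: "(\<And>j. f j \<in> grade d) \<Longrightarrow> f \<longlonglongrightarrow> x \<Longrightarrow> x \<in> cgrade d"
  unfolding cgrade_def closure_sequential by blast

lemma cgradeE:
  assumes "x \<in> cgrade d"
  obtains f where "\<And>j. f j \<in> grade d" "f \<longlonglongrightarrow> x"
  using assms unfolding cgrade_def closure_sequential by blast

lemma cgrade_add: "x \<in> cgrade d \<Longrightarrow> y \<in> cgrade d \<Longrightarrow> x + y \<in> cgrade d"
  unfolding cgrade_def closure_sequential
  by (elim exE conjE, rule exI, rule conjI[OF _ tendsto_add]) (auto intro: grade_add)

lemma cgrade_mult_grade:
  assumes "x \<in> cgrade d" "y \<in> grade e"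
  shows "x * y \<in> cgrade (d + e)"
proof -
  obtain f where f: "\<And>j. f j \<in> grade d" "f \<longlonglongrightarrow> x" using cgradeE[OF assms(1)] by blast
  have "(\<lambda>j. f j * y) \<longlonglongrightarrow> x * y" by (intro tendsto_mult f tendsto_const)
  moreover have "f j * y \<in> grade (d + e)" for j by (intro grade_mult f assms)
  ultimately show ?thesis by (intro cgradeI[of "\<lambda>j. f j * y"])
qed

lemma grade_diff: "x \<in> grade d \<Longrightarrow> y \<in> grade d \<Longrightarrow> x - y \<in> grade d"
  using grade_add[of x d "scal (-1) * y"] grade_scal[of y d "-1"] by (simp add: scal_minus)

lemma cgrade_diff: "x \<in> cgrade d \<Longrightarrow> y \<in> cgrade d \<Longrightarrow> x - y \<in> cgrade d"
  unfolding cgrade_def closure_sequential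
  by (elim exE conjE, rule exI, rule conjI[OF _ tendsto_diff]) (auto intro: grade_diff)

lemma kms:
  assumes "x \<in> cgrade d"
  shows "phi (y * x) = of_nat n powi d * phi (x * y)"
proof -
  have grade: "phi (y * x) = of_nat n powi d * phi (x * y)" if x: "x \<in> grade d" for x
  proof -
    obtain p q where "x \<in> blk p q" and d: "int p - int q = d" using x by (auto simp: grade_def)
    then show ?thesis using blk_kms[of x p q y] n2
      unfolding d[symmetric] by (simp add: power_int_diff divide_simps mult.commute)
  qed
  obtain f where f: "\<And>j. f j \<in> grade d" "f \<longlonglongrightarrow> x" using cgradeE[OF assms] by blast
  have "(\<lambda>j. phi (y * f j)) \<longlonglongrightarrow> phi (y * x)"
    by (intro tendsto_intros f)
  moreover have "(\<lambda>j. of_nat n powi d * phi (f j * y)) \<longlonglongrightarrow> of_nat n powi d * phi (x * y)"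
    by (intro tendsto_intros f)
  ultimately show ?thesis
    using LIMSEQ_unique by (simp add: grade f(1))
qed

lemma phi_normal:
  assumes "x \<in> cgrade d" "d \<noteq> 0" "x * st x = st x * x"
  shows "phi (st x * x) = 0"
proof -
  have "real n powi d \<noteq> 1"
  proof (cases "d > 0")
    case True
    then have "1 < real n ^ nat d" using n2 by (intro one_less_power) auto
    then show ?thesis using True by (simp add: power_int_def)
  next
    case False
    then have "1 < real n ^ nat (- d)" using n2 assms(2) by (intro one_less_power) auto
    then show ?thesis using False by (auto simp: power_int_def field_simps)
  qed
  then have "complex_of_nat n powi d \<noteq> 1"
    using of_real_eq_1_iff[of "real n powi d", where ?'a = complex] by simp
  then show ?thesis using kms[OF assms(1), of "st x"] assms(3) by simp
qed

text \<open>The averaging identity replaces \<open>x\<close> by the elements \<open>x * s i\<close>,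
  which have one right letter fewer. Once none is left, \<open>st x * x\<close> itself is a scalar,
  a sum of squared moduli.\<close>

lemma blk_phi_nonneg: "x \<in> blk p q \<Longrightarrow> phi (st x * x) \<in> \<real>\<^sub>\<ge>\<^sub>0"
proof (induction q arbitrary: x)
  case 0
  have "\<exists>r\<in>\<real>\<^sub>\<ge>\<^sub>0. st x * x = scal r" if "x \<in> blk p 0" for x p
    using that
  proof (induction p arbitrary: x)
    case 0
    then obtain c where "x = scal c" by auto
    then have "st x * x = scal (of_real ((cmod c)\<^sup>2))"
      by (metis complex_norm_square mult.commute scal_mult st_scal)
    moreover have "complex_of_real ((cmod c)\<^sup>2) \<in> \<real>\<^sub>\<ge>\<^sub>0" by (simp only: nonneg_Reals_of_real_iff) simp
    ultimately show ?case by blast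
  next
    case (Suc p)
    then have "\<forall>i<n. \<exists>r\<in>\<real>\<^sub>\<ge>\<^sub>0. st (st (s i) * x) * (st (s i) * x) = scal r" by simp
    then obtain r where r: "\<And>i. i < n \<Longrightarrow> r i \<in> \<real>\<^sub>\<ge>\<^sub>0 \<and> st (st (s i) * x) * (st (s i) * x) = scal (r i)"
      by metis
    have "st x * x = (\<Sum>i<n. st (st (s i) * x) * (st (s i) * x))"
      by (subst (2) expand_left[of x]) (simp add: sum_distrib_left st_mult mult.assoc)
    also have "\<dots> = scal (\<Sum>i<n. r i)" using r by (simp add: scal_sum)
    finally show ?case using r by (intro bexI[of _ "\<Sum>i<n. r i"]) (auto intro!: sum_nonneg_Reals)
  qed
  then show ?case using 0 by (metis phi_scal)
next
  case (Suc q)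
  have "phi (st x * x) = inverse (of_nat n) * (n * phi (st x * x))"
    using n2 by simp
  also have "n * phi (st x * x) = (\<Sum>i<n. phi (st (x * s i) * (x * s i)))"
    by (simp add: phi_eq_average st_mult mult.assoc)
  finally have "phi (st x * x) = inverse (of_nat n) * (\<Sum>i<n. phi (st (x * s i) * (x * s i)))" .
  moreover have "(\<Sum>i<n. phi (st (x * s i) * (x * s i))) \<in> \<real>\<^sub>\<ge>\<^sub>0"
    using Suc by (intro sum_nonneg_Reals) (auto simp: blk_Suc_right)
  ultimately show ?case by (simp only: nonneg_Reals_mult_I nonneg_Reals_inverse_I nonneg_Reals_of_nat_I)
qed

lemma phi_nonneg:
  assumes "x \<in> cgrade d"
  shows "phi (st x * x) \<in> \<real>\<^sub>\<ge>\<^sub>0"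
proof -
  obtain f where f: "\<And>j. f j \<in> grade d" "f \<longlonglongrightarrow> x" using cgradeE[OF assms] by blast
  have "(\<lambda>j. phi (st (f j) * f j)) \<longlonglongrightarrow> phi (st x * x)" by (intro tendsto_intros f)
  moreover have "phi (st (f j) * f j) \<in> \<real>\<^sub>\<ge>\<^sub>0" for j
    using f(1)[of j] blk_phi_nonneg by (auto simp: grade_def simp del: blk_simps)
  ultimately show ?thesis
    by (intro Lim_in_closed_set[OF closed_nonneg_Reals_complex _ trivial_limit_sequentially,
          of "\<lambda>j. phi (st (f j) * f j)"]) simp_all
qed

end

section \<open>Faithfulness\<close>

text \<open>A fixed factor \<open>K\<close> disappears when roots of growing order are
  taken.\<close>

lemma le_of_dyadic_powers_le:
  fixes a r K :: real
  assumes r: "0 \<le> r" and le: "\<And>i. a ^ (2 ^ i) \<le> K * r ^ (2 ^ i)"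
  shows "a \<le> r"
proof (rule ccontr)
  assume "\<not> a \<le> r"
  then have "r < a" by simp
  show False
  proof (cases "r = 0")
    case True
    then show False using le[of 0] \<open>r < a\<close> by simp
  next
    case False
    then have "r > 0" using r by simp
    then have "1 < a / r" using \<open>r < a\<close> by simp
    then obtain k where k: "K < (a / r) ^ k" using real_arch_pow by blast
    also have "(a / r) ^ k \<le> (a / r) ^ (2 ^ k)"
      using \<open>1 < a / r\<close> by (intro power_increasing) (auto simp: less_imp_le)
    also have "\<dots> \<le> K"
      using le[of k] \<open>r > 0\<close> by (simp add: power_divide divide_le_eq)
    finally show False by simp
  qed
qed

lemma nonneg_Reals_sum_eq_0D:
  fixes f :: "'b \<Rightarrow> complex"
  assumes "finite I" "\<And>i. i \<in> I \<Longrightarrow> f i \<in> \<real>\<^sub>\<ge>\<^sub>0" "sum f I = 0" "i \<in> I"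
  shows "f i = 0"
proof -
  have "(\<Sum>i\<in>I. Re (f i)) = 0"
    using arg_cong[OF assms(3), of Re] by simp
  then have "Re (f i) = 0"
    using assms by (subst (asm) sum_nonneg_eq_0_iff) (auto simp: complex_nonneg_Reals_iff)
  then show ?thesis
    using assms(2,4) by (auto simp: complex_nonneg_Reals_iff complex_eq_iff)
qed

context cuntz
begin

text \<open>By the parallelogram law the values for \<open>x + y\<close> and \<open>x - y\<close>
  add up to zero, and both are nonnegative. This bypasses the Cauchy-Schwarz inequality.\<close>

lemma phi_null_add:
  assumes "x \<in> cgrade d" "y \<in> cgrade d" "phi (st x * x) = 0" "phi (st y * y) = 0"
  shows "phi (st (x + y) * (x + y)) = 0"
proof -
  let ?a = "phi (st (x + y) * (x + y))" and ?b = "phi (st (x - y) * (x - y))"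
  have "?a + ?b = 0"
    using assms(3,4) by (simp add: st_add st_diff algebra_simps phi_add phi_diff)
  moreover have "?a \<in> \<real>\<^sub>\<ge>\<^sub>0" "?b \<in> \<real>\<^sub>\<ge>\<^sub>0"
    using assms by (auto intro: phi_nonneg cgrade_add cgrade_diff)
  ultimately show ?thesis
    by (auto simp: complex_nonneg_Reals_iff complex_eq_iff)
qed

lemma phi_null_sum:
  assumes "\<And>i. i \<in> I \<Longrightarrow> f i \<in> cgrade d \<and> phi (st (f i) * f i) = 0"
  shows "sum f I \<in> cgrade d \<and> phi (st (sum f I) * sum f I) = 0"
  using assms
proof (induction I rule: infinite_finite_induct)
  case (insert i I)
  then show ?case
    using cgrade_add[of "f i" d "sum f I"] phi_null_add[of "f i" d "sum f I"] by simp
qed (simp_all add: grade_imp_cgrade grade_0)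

text \<open>The values of \<open>phi\<close> for the elements \<open>y * s i\<close> sum to
  \<open>n\<close> times the value for \<open>y\<close>, which is zero; being nonnegative, each
  vanishes. The letters of \<open>v\<close> are absorbed in this way one by one, and
  \<open>phi_null_sum\<close> reassembles \<open>y * v\<close>.\<close>

lemma phi_null_mult_analytic:
  "v \<in> blk q 0 \<Longrightarrow> y \<in> cgrade d \<Longrightarrow> phi (st y * y) = 0 \<Longrightarrow>
    y * v \<in> cgrade (d + int q) \<and> phi (st (y * v) * (y * v)) = 0"
proof (induction q arbitrary: v y d)
  case 0
  then obtain c where c: "v = scal c" by auto
  have "y * v \<in> cgrade (d + int 0)"
    using 0 by (intro cgrade_mult_grade gradeI[OF 0(1)]) auto
  moreover have "st (y * v) * (y * v) = scal (cnj c * c) * (st y * y)"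
    unfolding c st_mult st_scal by (metis mult.assoc scal_commute scal_mult)
  ultimately show ?case using 0 by (simp add: phi_scal_mult)
next
  case (Suc q)
  have s: "s i \<in> grade 1" if "i < n" for i
    using isometry_in_blk[OF that] by (rule gradeI) simp
  have "(\<Sum>i<n. phi (st (y * s i) * (y * s i))) = n * phi (st y * y)"
    by (simp add: phi_eq_average st_mult mult.assoc)
  then have "(\<Sum>i<n. phi (st (y * s i) * (y * s i))) = 0" using Suc.prems by simp
  then have "phi (st (y * s i) * (y * s i)) = 0" if "i < n" for i
    using nonneg_Reals_sum_eq_0D[of "{..<n}" "\<lambda>i. phi (st (y * s i) * (y * s i))" i]
      phi_nonneg[OF cgrade_mult_grade[OF Suc.prems(2) s]] that by auto
  then have "(y * s i) * (st (s i) * v) \<in> cgrade (d + 1 + int q) \<and>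
      phi (st ((y * s i) * (st (s i) * v)) * ((y * s i) * (st (s i) * v))) = 0" if "i < n" for i
    using Suc.prems cgrade_mult_grade[OF Suc.prems(2) s] that by (intro Suc.IH) auto
  then have "(\<Sum>i<n. (y * s i) * (st (s i) * v)) \<in> cgrade (d + 1 + int q) \<and>
      phi (st (\<Sum>i<n. (y * s i) * (st (s i) * v)) * (\<Sum>i<n. (y * s i) * (st (s i) * v))) = 0"
    by (intro phi_null_sum) auto
  moreover have "(\<Sum>i<n. (y * s i) * (st (s i) * v)) = y * v"
    by (subst (2) expand_left[of v]) (simp add: sum_distrib_left mult.assoc)
  ultimately show ?case by (simp add: algebra_simps)
qed

text \<open>A crude bound from the triangle inequality over all words of length \<open>q\<close>.
  The factor \<open>real n ^ q\<close> is harmless, since passing to dyadic powers removes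
  it.\<close>

lemma norm_le_of_analytic:
  "(\<And>v. v \<in> blk q 0 \<Longrightarrow> norm (x * v) \<le> r * norm v) \<Longrightarrow> norm x \<le> real n ^ q * r"
proof (induction q arbitrary: x)
  case 0
  have "1 \<in> blk 0 0" using range_eqI[of 1 scal 1] by simp
  then show ?case using 0[of 1] by simp
next
  case (Suc q)
  have "norm (x * s i * st (s i)) \<le> real n ^ q * r" if "i < n" for i
  proof -
    have "norm (x * s i) \<le> real n ^ q * r"
    proof (rule Suc.IH)
      fix v assume "v \<in> blk q 0"
      then have "norm (x * (s i * v)) \<le> r * norm (s i * v)"
        by (intro Suc.prems blk_isometry_mult that)
      then show "norm (x * s i * v) \<le> r * norm v"
        by (simp add: norm_isometry_mult that mult.assoc)
    qed
    then show ?thesis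
      using norm_mult_ineq[of "x * s i" "st (s i)"] that by (simp add: norm_isometry)
  qed
  then have "norm (\<Sum>i<n. x * s i * st (s i)) \<le> (\<Sum>i<n. real n ^ q * r)"
    by (intro sum_norm_le) auto
  then show ?case using expand_right[of x] by simp
qed

text \<open>An element of \<open>blk p q\<close> is a matrix, and by the C*-identity its norm is the operator norm
  on the Hilbert space \<open>blk q 0\<close>.\<close>
lemma blk_norm_le:
  assumes c: "c \<in> blk p q" and r: "0 \<le> r"
    and le: "\<And>v. v \<in> blk q 0 \<Longrightarrow> norm (c * v) \<le> r * norm v"
  shows "norm c \<le> r"
proof -
  \<comment> \<open>Unlike \<open>c\<close>, the self-adjoint \<open>g\<close> maps
    \<open>blk q 0\<close> to itself and can be iterated. The crude bound applied to its dyadic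
    powers then yields the sharp one.\<close>
  define g where "g = st c * c"
  have sc: "st c \<in> blk q p" by (rule blk_st[OF c])
  have le_st: "norm (st c * w) \<le> r * norm w" if w: "w \<in> blk p 0" for w
  proof (cases "st c * w = 0")
    case False
    have "norm (st c * w) * norm (st c * w) = norm (st w * (c * (st c * w)))"
      using norm_st_mult[of "st c * w"] by (simp add: st_mult power2_eq_square mult.assoc)
    also have "\<dots> \<le> norm w * norm (c * (st c * w))"
      using norm_mult_ineq[of "st w"] by simp
    also have "\<dots> \<le> norm w * (r * norm (st c * w))"
      using blk_mult[OF sc w] by (intro mult_left_mono le) auto
    finally show ?thesis using False by (simp add: mult_ac)
  qed (use r in simp)
  have g: "g * v \<in> blk q 0 \<and> norm (g * v) \<le> r\<^sup>2 * norm v" if v: "v \<in> blk q 0" for v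
  proof -
    have cv: "c * v \<in> blk p 0" by (rule blk_mult[OF c v])
    have "norm (st c * (c * v)) \<le> r * (r * norm v)"
      using le_st[OF cv] mult_left_mono[OF le[OF v] r] by linarith
    then show ?thesis
      using blk_mult[OF sc cv] by (simp add: g_def mult.assoc power2_eq_square)
  qed
  have gj: "g ^ j * v \<in> blk q 0 \<and> norm (g ^ j * v) \<le> (r\<^sup>2) ^ j * norm v" if v: "v \<in> blk q 0" for j v
  proof (induction j)
    case (Suc j)
    have "norm (g * (g ^ j * v)) \<le> r\<^sup>2 * norm (g ^ j * v)" using g Suc by blast
    also have "\<dots> \<le> r\<^sup>2 * ((r\<^sup>2) ^ j * norm v)" using Suc by (intro mult_left_mono) auto
    finally show ?case using g Suc by (simp add: mult.assoc)
  qed (use v in simp)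
  have "(norm g) ^ (2 ^ i) \<le> real n ^ q * (r\<^sup>2) ^ (2 ^ i)" for i
  proof -
    have "st g = g" by (simp add: g_def st_mult)
    then have "(norm g) ^ (2 ^ i) = norm (g ^ (2 ^ i))" by (simp add: norm_self_adjoint_power)
    also have "\<dots> \<le> real n ^ q * (r\<^sup>2) ^ (2 ^ i)" using gj by (intro norm_le_of_analytic) blast
    finally show ?thesis .
  qed
  then have "norm g \<le> r\<^sup>2" by (rule le_of_dyadic_powers_le[OF zero_le_power2])
  then have "(norm c)\<^sup>2 \<le> r\<^sup>2" by (simp add: g_def norm_st_mult)
  then show ?thesis using r by (rule power2_le_imp_le)
qed

text \<open>If \<open>c\<close> in a block is close to \<open>y\<close>, some \<open>v\<close> in
  \<open>blk q 0\<close> has \<open>c * v\<close> large compared with \<open>y * v - c * v\<close>.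
  But \<open>phi\<close> takes the value zero for \<open>y * v\<close> and a value of modulus
  \<open>(norm (c * v))\<^sup>2\<close> for \<open>c * v\<close>, which is too large a gap.\<close>

lemma phi_faithful:
  assumes y: "y \<in> cgrade d" "phi (st y * y) = 0"
  shows "y = 0"
proof (rule ccontr)
  assume "y \<noteq> 0"
  \<comment> \<open>A quarter leaves \<open>3 * e < norm c\<close>, hence \<open>3 * b < a\<close>
    below; the three error terms then total at most \<open>3 * b * a < a\<^sup>2\<close>.\<close>
  define e where "e = norm y / 4"
  have e: "e > 0" using \<open>y \<noteq> 0\<close> by (simp add: e_def)
  obtain c where "c \<in> grade d" and yc: "norm (y - c) < e"
    using y(1) e unfolding cgrade_def closure_approachable by (metis dist_commute dist_norm)
  then obtain p q where c: "c \<in> blk p q" by (auto simp: grade_def)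
  have "3 * e < norm c"
    using yc norm_triangle_ineq2[of y c] by (simp add: e_def)
  then have "\<not> (\<forall>v\<in>blk q 0. norm (c * v) \<le> 3 * e * norm v)"
    using blk_norm_le[OF c, of "3 * e"] e by auto
  then obtain v where v: "v \<in> blk q 0" and cv: "3 * e * norm v < norm (c * v)" by auto
  define a where "a = norm (c * v)"
  define b where "b = e * norm v"
  have ab: "0 \<le> b" "3 * b < a" using e cv by (auto simp: a_def b_def)
  have "c * v \<in> blk p 0" by (rule blk_mult[OF c v])
  then obtain z where z: "st (c * v) * (c * v) = scal z" using blk_inner by blast
  have "cmod z = a\<^sup>2"
    using arg_cong[OF z, of norm] by (simp add: norm_st_mult a_def)
  let ?d = "y * v - c * v"
  have nd: "norm ?d \<le> b"
    using order_trans[OF norm_mult_ineq[of "y - c" v] mult_right_mono[of "norm (y - c)" e "norm v"]] yc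
    by (simp add: b_def algebra_simps)
  have "phi (st (y * v) * (y * v)) = 0"
    using phi_null_mult_analytic[OF v y] by simp
  then have "phi (st (y * v) * (y * v) - st (c * v) * (c * v)) = - z"
    by (simp only: phi_diff z phi_scal) simp
  then have "a\<^sup>2 \<le> norm (st (y * v) * (y * v) - st (c * v) * (c * v))"
    using norm_phi \<open>cmod z = a\<^sup>2\<close> by (metis norm_minus_cancel)
  also have "st (y * v) * (y * v) - st (c * v) * (c * v) = st ?d * ?d + st ?d * (c * v) + st (c * v) * ?d"
    by (simp add: st_diff algebra_simps)
  also have "norm \<dots> \<le> norm ?d * norm ?d + norm ?d * a + a * norm ?d"
    unfolding a_def
    by (intro norm_triangle_mono order_trans[OF norm_mult_ineq]) simp_all
  also have "\<dots> \<le> b * b + b * a + a * b"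
    using nd ab by (intro add_mono mult_mono) auto
  also have "\<dots> < a\<^sup>2"
  proof -
    have "b * b \<le> b * a" using ab by (intro mult_left_mono) auto
    moreover have "(3 * b) * a < a * a" using ab by (intro mult_strict_right_mono) auto
    ultimately show ?thesis by (simp add: power2_eq_square algebra_simps)
  qed
  finally show False by simp
qed

lemma normal_homogeneous_eq_0:
  assumes "x \<in> cgrade d" "d \<noteq> 0" "x * st x = st x * x"
  shows "x = 0"
  using phi_faithful[OF assms(1) phi_normal[OF assms]] .

end

section \<open>Fourier analysis of the circle action\<close>

definition unit_root :: "nat \<Rightarrow> nat \<Rightarrow> complex" where
  "unit_root N j = cis (2 * pi * j / N)"

lemma norm_unit_root [simp]: "cmod (unit_root N j) = 1"
  by (simp add: unit_root_def)

lemma sum_unit_root_powi: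
  assumes "\<bar>m\<bar> < int N"
  shows "(\<Sum>j<N. unit_root N j powi m) = (if m = 0 then of_nat N else 0)"
proof -
  define w where "w = cis (2 * pi * m / N)"
  have N: "N > 0" using assms by (cases N) auto
  have pow: "unit_root N j powi m = w ^ j" for j
    by (simp add: unit_root_def w_def cis_power_int Complex.DeMoivre mult_ac)
  have "w ^ N = cis (2 * pi * of_int m)"
    using N by (simp add: w_def Complex.DeMoivre)
  then have wN: "w ^ N = 1" by (simp only: cis_multiple_2pi Ints_of_int)
  show ?thesis
  proof (cases "m = 0")
    case False
    have "w \<noteq> 1"
    proof
      assume "w = 1"
      then obtain k :: int where "2 * pi * m / N = of_int (2 * k) * pi"
        by (auto simp: w_def cis_conv_exp exp_eq_1)
      then have "real_of_int m = of_int (k * int N)"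
        using N by (simp add: field_simps)
      then have "int N dvd m" by (simp only: of_int_eq_iff) simp
      then show False using zdvd_imp_le[of "int N" "\<bar>m\<bar>"] False assms by simp
    qed
    then show ?thesis using False by (simp add: pow geometric_sum wN)
  qed simp
qed

lemma powi_diff_unit: "cmod t = 1 \<Longrightarrow> t powi (int i - int l) = t ^ i * cnj (t ^ l)"
proof -
  assume t: "cmod t = 1"
  then have "t * cnj t = 1" by (simp add: complex_norm_square[symmetric])
  then have "cnj t = inverse t" by (metis inverse_unique)
  moreover have "t \<noteq> 0" using t by auto
  ultimately show ?thesis by (simp add: power_int_diff divide_inverse power_inverse)
qed

text \<open>The Fejer kernel; as a double sum it is, on the circle, the squared modulus of a
  geometric sum divided by \<open>K\<close>, hence nonnegative.\<close>

definition fejer :: "nat \<Rightarrow> complex \<Rightarrow> complex" where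
  "fejer K t = (\<Sum>i<K. \<Sum>l<K. t powi (int i - int l)) / of_nat K"

lemma fejer_nonneg: "cmod t = 1 \<Longrightarrow> complex_of_real (cmod (fejer K t)) = fejer K t"
proof -
  assume t: "cmod t = 1"
  define z where "z = (\<Sum>i<K. t ^ i)"
  have "(\<Sum>i<K. \<Sum>l<K. t powi (int i - int l)) = z * cnj z"
    by (simp add: powi_diff_unit[OF t] z_def sum_product)
  then have "fejer K t = of_real ((cmod z)\<^sup>2 / K)"
    by (simp only: fejer_def of_real_divide complex_norm_square of_real_of_nat_eq)
  then show ?thesis by (simp only: norm_of_real) simp
qed

text \<open>Nonnegativity turns the moduli into plain values, and \<open>K \<le> N\<close> keeps all
  differences \<open>i - l\<close> below \<open>N\<close>, so that only the diagonal
  survives.\<close>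

lemma sum_fejer_unit_root:
  assumes "0 < K" "K \<le> N"
  shows "(\<Sum>j<N. cmod (fejer K (unit_root N j))) = N"
proof -
  have "complex_of_real (\<Sum>j<N. cmod (fejer K (unit_root N j))) = (\<Sum>j<N. fejer K (unit_root N j))"
    by (simp add: fejer_nonneg)
  also have "\<dots> = (\<Sum>j<N. \<Sum>i<K. \<Sum>l<K. unit_root N j powi (int i - int l)) / of_nat K"
    by (simp add: fejer_def sum_divide_distrib)
  also have "(\<Sum>j<N. \<Sum>i<K. \<Sum>l<K. unit_root N j powi (int i - int l))
      = (\<Sum>i<K. \<Sum>l<K. \<Sum>j<N. unit_root N j powi (int i - int l))"
    by (simp only: sum.swap[of _ _ "{..<N}"])
  also have "\<dots> = (\<Sum>i<K. \<Sum>l<K. if i = l then of_nat N else 0)"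
    using assms by (intro sum.cong refl) (subst sum_unit_root_powi, auto)
  also have "\<dots> / of_nat K = of_nat N" using assms by simp
  finally show ?thesis by (metis of_real_eq_iff of_real_of_nat_eq)
qed

text \<open>Divided by \<open>K\<close>, this shows that the Fejer weight of a fixed frequency
  \<open>e\<close> tends to one.\<close>

lemma card_shifted_interval:
  "real K - \<bar>real_of_int e\<bar> \<le> (\<Sum>i<K. \<Sum>l<K. if int i - int l = e then 1 else (0::real))"
proof -
  have "(\<Sum>l<K. if int i - int l = e then 1 else (0::real)) = (if 0 \<le> int i - e \<and> int i - e < int K then 1 else 0)" for i
  proof -
    have "(int i - int l = e) = (l = nat (int i - e) \<and> 0 \<le> int i - e)" for l by auto
    then have "(\<Sum>l<K. if int i - int l = e then 1 else (0::real))
        = (\<Sum>l<K. if l = nat (int i - e) then (if 0 \<le> int i - e then 1 else 0) else 0)"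
      by (intro sum.cong) auto
    then show ?thesis by auto
  qed
  then have "(\<Sum>i<K. \<Sum>l<K. if int i - int l = e then 1 else (0::real))
      = card {i\<in>{..<K}. 0 \<le> int i - e \<and> int i - e < int K}"
    by (simp add: sum.If_cases Int_def)
  moreover have "{nat e..<K - nat (- e)} \<subseteq> {i\<in>{..<K}. 0 \<le> int i - e \<and> int i - e < int K}" by auto
  then have "card {nat e..<K - nat (- e)} \<le> card {i\<in>{..<K}. 0 \<le> int i - e \<and> int i - e < int K}"
    by (intro card_mono) auto
  ultimately show ?thesis by simp
qed

locale cuntz_circle = cuntz sm st n s
  for sm :: "complex \<Rightarrow> 'a::{real_normed_algebra_1,banach} \<Rightarrow> 'a" and st :: "'a \<Rightarrow> 'a"
    and n :: nat and s :: "nat \<Rightarrow> 'a" +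
  fixes \<omega> :: "complex \<Rightarrow> 'a \<Rightarrow> 'a"
  assumes action: "std_circle_action sm st n s \<omega>"
begin

context
  fixes t :: complex
  assumes t: "cmod t = 1"
begin

section \<open>The automorphisms on words and homogeneous elements\<close>

lemmas omega_action = action[unfolded std_circle_action_def, THEN spec, THEN mp, OF t]

lemma bij_omega: "bij (\<omega> t)"
  using omega_action by simp

lemma omega_add: "\<omega> t (x + y) = \<omega> t x + \<omega> t y"
  using omega_action by simp

lemma omega_mult: "\<omega> t (x * y) = \<omega> t x * \<omega> t y"
  using omega_action by simp

lemma omega_scal_mult: "\<omega> t (scal c * x) = scal c * \<omega> t x"
  using omega_action by (simp flip: sm_conv_scal)

lemma omega_st: "\<omega> t (st x) = st (\<omega> t x)"
  using omega_action by simp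

lemma omega_isometry: "i < n \<Longrightarrow> \<omega> t (s i) = scal t * s i"
  using omega_action by (simp flip: sm_conv_scal)

lemma omega_1: "\<omega> t 1 = 1"
proof -
  obtain x where "\<omega> t x = 1" using bij_omega by (metis bij_pointE)
  then show ?thesis using omega_mult[of x 1] by simp
qed

lemma omega_scal: "\<omega> t (scal c) = scal c"
  using omega_scal_mult[of c 1] by (simp add: omega_1)

lemma norm_omega: "norm (\<omega> t x) \<le> norm x"
  using omega_1 omega_add omega_mult omega_scal_mult omega_st by (rule star_hom_contractive)

lemma omega_diff: "\<omega> t (x - y) = \<omega> t x - \<omega> t y"
  by (metis omega_add add_diff_cancel_right' diff_add_cancel)

lemma omega_0: "\<omega> t 0 = 0"
  using omega_diff[of 0 0] by simp

lemma omega_sum: "\<omega> t (sum f I) = (\<Sum>i\<in>I. \<omega> t (f i))"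
  by (induction I rule: infinite_finite_induct) (auto simp: omega_add omega_0)

lemma omega_blk: "x \<in> blk p q \<Longrightarrow> \<omega> t x = scal (t ^ p * cnj t ^ q) * x"
proof (induction p q arbitrary: x rule: nat_pair_induct)
  case 1
  then show ?case by (auto simp: omega_scal)
next
  case (2 q)
  have "\<omega> t (x * s i * st (s i)) = scal (cnj t ^ Suc q) * (x * s i * st (s i))" if "i < n" for i
  proof -
    have "\<omega> t (x * s i) = scal (cnj t ^ q) * (x * s i)"
      using 2 that by simp
    moreover have "\<omega> t (st (s i)) = scal (cnj t) * st (s i)"
      by (simp add: omega_st omega_isometry that st_mult st_scal scal_commute)
    ultimately have "\<omega> t (x * s i * st (s i)) = (scal (cnj t ^ q) * (x * s i)) * (scal (cnj t) * st (s i))"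
      using omega_mult[of "x * s i" "st (s i)"] by simp
    also have "\<dots> = scal (cnj t ^ q) * (scal (cnj t) * (x * s i * st (s i)))"
      by (simp only: mult.assoc scal_left_commute[of "s i"] scal_left_commute[of x])
    finally show ?thesis by (simp only: power_Suc2 scal_mult mult.assoc)
  qed
  then have "(\<Sum>i<n. \<omega> t (x * s i * st (s i))) = scal (cnj t ^ Suc q) * (\<Sum>i<n. x * s i * st (s i))"
    by (simp add: sum_distrib_left)
  then show ?case
    by (simp only: omega_sum[symmetric] expand_right[of x, symmetric]) simp
next
  case (3 p q)
  have "\<omega> t (s i * (st (s i) * x)) = scal (t ^ Suc p * cnj t ^ q) * (s i * (st (s i) * x))" if "i < n" for i
  proof -
    have "\<omega> t (st (s i) * x) = scal (t ^ p * cnj t ^ q) * (st (s i) * x)"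
      using 3 that by simp
    then have "\<omega> t (s i * (st (s i) * x)) = (scal t * s i) * (scal (t ^ p * cnj t ^ q) * (st (s i) * x))"
      using omega_mult[of "s i" "st (s i) * x"] by (simp add: omega_isometry that)
    also have "\<dots> = scal t * (scal (t ^ p * cnj t ^ q) * (s i * (st (s i) * x)))"
      by (simp only: mult.assoc scal_left_commute[of "s i"])
    finally show ?thesis by (simp only: power_Suc scal_mult mult.assoc)
  qed
  then have "(\<Sum>i<n. \<omega> t (s i * (st (s i) * x))) = scal (t ^ Suc p * cnj t ^ q) * (\<Sum>i<n. s i * (st (s i) * x))"
    by (simp add: sum_distrib_left)
  then show ?case
    by (simp only: omega_sum[symmetric] expand_left[of x, symmetric])
qed

lemma omega_grade: "x \<in> grade d \<Longrightarrow> \<omega> t x = scal (t powi d) * x"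
  using omega_blk by (auto simp: grade_def powi_diff_unit[OF t] simp del: blk_simps)

lemma omega_cgrade_0:
  assumes "x \<in> cgrade 0"
  shows "\<omega> t x = x"
proof -
  obtain f where f: "\<And>j. f j \<in> grade 0" "f \<longlonglongrightarrow> x" using cgradeE[OF assms] by blast
  have "norm (\<omega> t x - f j) \<le> norm (f j - x)" for j
    using norm_omega[of "x - f j"] omega_grade[OF f(1)]
    by (simp add: omega_diff norm_minus_commute)
  moreover have "(\<lambda>j. norm (f j - x)) \<longlonglongrightarrow> 0"
    using f(2) by (simp add: LIM_zero tendsto_norm_zero)
  moreover have "(\<lambda>j. norm (\<omega> t x - f j)) \<longlonglongrightarrow> norm (\<omega> t x - x)"
    by (intro tendsto_intros f)
  ultimately have "norm (\<omega> t x - x) \<le> 0"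
    using LIMSEQ_le[of "\<lambda>j. norm (\<omega> t x - f j)" _ "\<lambda>j. norm (f j - x)"] by blast
  then show ?thesis by simp
qed

end

text \<open>A Riemann sum for the circle integral of \<open>g t\<close> times
  \<open>\<omega> t x\<close>. Being a finite combination, it stays in every invariant subalgebra
  containing \<open>x\<close>, closed or not.\<close>

definition rot_avg :: "nat \<Rightarrow> (complex \<Rightarrow> complex) \<Rightarrow> 'a \<Rightarrow> 'a" where
  "rot_avg N g x = (1 / real N) *\<^sub>R (\<Sum>j<N. scal (g (unit_root N j)) * \<omega> (unit_root N j) x)"

lemma rot_avg_add: "rot_avg N g (x + y) = rot_avg N g x + rot_avg N g y"
  by (simp add: rot_avg_def omega_add distrib_left sum.distrib scaleR_add_right)

lemma rot_avg_diff: "rot_avg N g (x - y) = rot_avg N g x - rot_avg N g y"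
  by (metis rot_avg_add add_diff_cancel_right' diff_add_cancel)

lemma norm_rot_avg: "norm (rot_avg N g x) \<le> (\<Sum>j<N. cmod (g (unit_root N j))) / N * norm x"
proof -
  have "norm (\<Sum>j<N. scal (g (unit_root N j)) * \<omega> (unit_root N j) x)
      \<le> (\<Sum>j<N. cmod (g (unit_root N j)) * norm x)"
    by (intro sum_norm_le) (simp add: mult_left_mono norm_omega)
  then show ?thesis
    by (simp add: rot_avg_def divide_right_mono flip: sum_distrib_right)
qed

definition fourier :: "int \<Rightarrow> nat \<Rightarrow> 'a \<Rightarrow> 'a" where
  "fourier d N = rot_avg N (\<lambda>t. t powi (- d))"

lemma norm_fourier: "norm (fourier d N x) \<le> norm x"
proof (cases "N = 0")
  case False
  then show ?thesis
    using norm_rot_avg[of N "\<lambda>t. t powi (- d)" x] by (simp add: fourier_def norm_power_int)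
qed (simp add: fourier_def rot_avg_def)

text \<open>No aliasing occurs once \<open>N\<close> exceeds the distance of the degrees, so the
  discrete average is already the exact coefficient.\<close>

lemma fourier_grade:
  assumes x: "x \<in> grade e" and N: "\<bar>e - d\<bar> < int N"
  shows "fourier d N x = (if e = d then x else 0)"
proof -
  have "scal (unit_root N j powi (- d)) * \<omega> (unit_root N j) x
      = scal (unit_root N j powi (e - d)) * x" for j
  proof -
    have "unit_root N j \<noteq> 0" by (metis norm_unit_root norm_zero zero_neq_one)
    then have "unit_root N j powi (- d) * unit_root N j powi e = unit_root N j powi (e - d)"
      by (simp flip: power_int_add)
    then show ?thesis
      by (simp add: omega_grade[OF _ x] flip: mult.assoc scal_mult)
  qed
  then have "fourier d N x = (1 / real N) *\<^sub>R (scal (\<Sum>j<N. unit_root N j powi (e - d)) * x)"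
    by (simp add: fourier_def rot_avg_def scal_sum sum_distrib_right)
  moreover have "N > 0" using N by (cases N) auto
  ultimately show ?thesis
    by (auto simp: sum_unit_root_powi[OF N] scaleR_conv_scal simp flip: scal_mult mult.assoc)
qed

lemma fourier_grade_tendsto:
  assumes "x \<in> grade e"
  shows "(\<lambda>N. fourier d N x) \<longlonglongrightarrow> (if e = d then x else 0)"
proof (rule tendsto_eventually)
  show "\<forall>\<^sub>F N in sequentially. fourier d N x = (if e = d then x else 0)"
    using eventually_gt_at_top[of "nat \<bar>e - d\<bar>"]
  proof eventually_elim
    case (elim N)
    then show ?case by (intro fourier_grade[OF assms]) linarith
  qed
qed

lemma fourier_poly_tendsto: "x \<in> poly \<Longrightarrow> \<exists>y\<in>grade d. (\<lambda>N. fourier d N x) \<longlonglongrightarrow> y"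
proof (induction x rule: poly.induct)
  case (poly_grade x e)
  have "(if e = d then x else 0) \<in> grade d" using poly_grade grade_0 by (cases "e = d") simp_all
  then show ?case using fourier_grade_tendsto[OF poly_grade] by blast
next
  case (poly_add x y)
  then obtain u v where "u \<in> grade d" "v \<in> grade d"
      "(\<lambda>N. fourier d N x) \<longlonglongrightarrow> u" "(\<lambda>N. fourier d N y) \<longlonglongrightarrow> v" by blast
  then show ?case
    by (intro bexI[of _ "u + v"]) (auto simp: fourier_def rot_avg_add intro: tendsto_add grade_add)
qed

definition spectral :: "int \<Rightarrow> 'a \<Rightarrow> 'a" where
  "spectral d x = lim (\<lambda>N. fourier d N x)"

lemma fourier_tendsto_spectral: "(\<lambda>N. fourier d N x) \<longlonglongrightarrow> spectral d x"
proof -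
  have "convergent (\<lambda>N. fourier d N x)"
  proof (rule contractions_convergent[OF _ norm_fourier])
    show "fourier d m (x - y) = fourier d m x - fourier d m y" for m x y
      by (simp add: fourier_def rot_avg_diff)
    show "\<exists>y. norm (x - y) < e \<and> convergent (\<lambda>N. fourier d N y)" if "e > 0" for e
      using poly_dense[OF that, of x] fourier_poly_tendsto convergentI by blast
  qed
  then show ?thesis by (simp add: spectral_def convergent_LIMSEQ_iff)
qed

lemma spectral_add: "spectral d (x + y) = spectral d x + spectral d y"
proof (rule LIMSEQ_unique[OF fourier_tendsto_spectral])
  show "(\<lambda>N. fourier d N (x + y)) \<longlonglongrightarrow> spectral d x + spectral d y"
    unfolding fourier_def rot_avg_add
    by (intro tendsto_add fourier_tendsto_spectral[unfolded fourier_def])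
qed

lemma spectral_diff: "spectral d (x - y) = spectral d x - spectral d y"
  by (metis spectral_add add_diff_cancel_right' diff_add_cancel)

lemma norm_spectral: "norm (spectral d x) \<le> norm x"
  by (rule LIMSEQ_le_const2[OF tendsto_norm[OF fourier_tendsto_spectral]]) (use norm_fourier in blast)

lemma spectral_grade: "x \<in> grade e \<Longrightarrow> spectral d x = (if e = d then x else 0)"
  using LIMSEQ_unique[OF fourier_tendsto_spectral fourier_grade_tendsto] .

lemma spectral_in_cgrade: "spectral d x \<in> cgrade d"
  unfolding cgrade_def closure_approachable
proof (intro allI impI)
  fix e :: real assume "e > 0"
  then obtain p where p: "p \<in> poly" "norm (x - p) < e" using poly_dense by blast
  have "spectral d p \<in> grade d"
    using fourier_poly_tendsto[OF p(1)] LIMSEQ_unique[OF fourier_tendsto_spectral] by blast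
  moreover have "dist (spectral d p) (spectral d x) < e"
    using norm_spectral[of d "x - p"] p(2) by (simp add: spectral_diff dist_norm norm_minus_commute)
  ultimately show "\<exists>y\<in>grade d. dist y (spectral d x) < e" by blast
qed

text \<open>The Cesaro mean of the Fourier series, preferred to partial sums because it is
  contractive. The sign of \<open>int l - int i\<close> is opposite to that in \<open>fejer\<close>,
  since \<open>fourier d\<close> averages against \<open>t powi (- d)\<close>.\<close>

definition cesaro :: "nat \<Rightarrow> 'a \<Rightarrow> 'a" where
  "cesaro K x = (1 / real K) *\<^sub>R (\<Sum>i<K. \<Sum>l<K. spectral (int l - int i) x)"

lemma cesaro_add: "cesaro K (x + y) = cesaro K x + cesaro K y"
  by (simp add: cesaro_def spectral_add sum.distrib scaleR_add_right)

lemma cesaro_diff: "cesaro K (x - y) = cesaro K x - cesaro K y"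
  by (metis cesaro_add add_diff_cancel_right' diff_add_cancel)

lemma rot_avg_fejer:
  "rot_avg N (fejer K) x = (1 / real K) *\<^sub>R (\<Sum>i<K. \<Sum>l<K. fourier (int l - int i) N x)"
proof -
  have "scal (fejer K t) * y = (1 / real K) *\<^sub>R (\<Sum>i<K. \<Sum>l<K. scal (t powi (int i - int l)) * y)" for t y
  proof -
    have "fejer K t = of_real (1 / real K) * (\<Sum>i<K. \<Sum>l<K. t powi (int i - int l))"
      by (simp add: fejer_def)
    then show ?thesis
      by (simp only: scal_mult scal_sum scaleR_conv_scal sum_distrib_right mult.assoc)
  qed
  then have "(\<Sum>j<N. scal (fejer K (unit_root N j)) * \<omega> (unit_root N j) x)
      = (1 / real K) *\<^sub>R (\<Sum>i<K. \<Sum>l<K. \<Sum>j<N. scal (unit_root N j powi (int i - int l)) * \<omega> (unit_root N j) x)"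
    by (simp only: scaleR_right.sum[symmetric] sum.swap[of _ _ "{..<N}"])
  then show ?thesis
    by (simp add: rot_avg_def fourier_def scaleR_right.sum[symmetric] scaleR_left_commute)
qed

text \<open>For \<open>N \<ge> K\<close> the average against the nonnegative kernel of mean one is a
  contraction; letting \<open>N\<close> grow gives the Cesaro mean.\<close>

lemma norm_cesaro: "0 < K \<Longrightarrow> norm (cesaro K x) \<le> norm x"
proof -
  assume K: "0 < K"
  have "(\<lambda>N. norm (rot_avg N (fejer K) x)) \<longlonglongrightarrow> norm (cesaro K x)"
    unfolding rot_avg_fejer cesaro_def
    by (intro tendsto_norm tendsto_scaleR tendsto_const tendsto_sum fourier_tendsto_spectral)
  moreover have "norm (rot_avg N (fejer K) x) \<le> norm x" if "N \<ge> K" for N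
    using norm_rot_avg[of N "fejer K" x] K that by (simp add: sum_fejer_unit_root)
  ultimately show ?thesis by (intro LIMSEQ_le_const2) blast+
qed

lemma cesaro_grade_tendsto:
  assumes "x \<in> grade e"
  shows "(\<lambda>K. cesaro K x) \<longlonglongrightarrow> x"
proof -
  define c where "c K = (\<Sum>i<K. \<Sum>l<K. if int i - int l = - e then 1 else (0::real))" for K
  have ces: "cesaro K x = (c K / K) *\<^sub>R x" for K
  proof -
    have "(\<Sum>i<K. \<Sum>l<K. spectral (int l - int i) x) = (\<Sum>i<K. \<Sum>l<K. (if int i - int l = - e then 1 else 0) *\<^sub>R x)"
      using assms by (intro sum.cong refl) (auto simp: spectral_grade)
    also have "\<dots> = c K *\<^sub>R x" by (simp only: c_def scaleR_left.sum)
    finally show ?thesis by (simp add: cesaro_def)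
  qed
  have lower: "1 - \<bar>real_of_int e\<bar> / K \<le> c K / K" if "K > 0" for K
    using divide_right_mono[OF card_shifted_interval[of K "- e"], of K] that
    by (simp add: c_def diff_divide_distrib)
  have upper: "c K / K \<le> 1" if "K > 0" for K
  proof -
    have "c K \<le> (\<Sum>i<K. 1)"
      unfolding c_def
    proof (rule sum_mono)
      fix i
      have "(\<Sum>l<K. if int i - int l = - e then 1 else (0::real)) \<le> (\<Sum>l<K. if l = nat (int i + e) then 1 else 0)"
        by (intro sum_mono) auto
      also have "\<dots> \<le> 1" by simp
      finally show "(\<Sum>l<K. if int i - int l = - e then 1 else (0::real)) \<le> 1" .
    qed
    then show ?thesis using that by simp
  qed
  have "(\<lambda>K. 1 - \<bar>real_of_int e\<bar> / real K) \<longlonglongrightarrow> 1 - 0"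
    by (intro tendsto_diff tendsto_const lim_const_over_n)
  moreover have "\<forall>\<^sub>F K in sequentially. 1 - \<bar>real_of_int e\<bar> / real K \<le> c K / K"
    using eventually_gt_at_top[of 0] by eventually_elim (rule lower)
  moreover have "\<forall>\<^sub>F K in sequentially. c K / K \<le> 1"
    using eventually_gt_at_top[of 0] by eventually_elim (rule upper)
  ultimately have "(\<lambda>K. c K / real K) \<longlonglongrightarrow> 1"
    using tendsto_sandwich[OF _ _ _ tendsto_const] by force
  from tendsto_scaleR[OF this tendsto_const[of x]] show ?thesis by (simp add: ces)
qed

lemma cesaro_poly_tendsto: "x \<in> poly \<Longrightarrow> (\<lambda>K. cesaro K x) \<longlonglongrightarrow> x"
  by (induction x rule: poly.induct) (auto simp: cesaro_add intro: tendsto_add cesaro_grade_tendsto)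

lemma cesaro_tendsto: "(\<lambda>K. cesaro K x) \<longlonglongrightarrow> x"
proof (rule LIMSEQ_I)
  fix e :: real assume "e > 0"
  then obtain p where p: "p \<in> poly" "norm (x - p) < e / 3" using poly_dense[of "e / 3"] by auto
  obtain M where M: "\<And>K. K \<ge> M \<Longrightarrow> norm (cesaro K p - p) < e / 3"
    using LIMSEQ_D[OF cesaro_poly_tendsto[OF p(1)], of "e / 3"] \<open>e > 0\<close> by auto
  have "norm (cesaro K x - x) < e" if "K \<ge> Suc M" for K
  proof -
    have "cesaro K x - x = cesaro K (x - p) + (cesaro K p - p) - (x - p)"
      by (simp add: cesaro_diff)
    also have "norm \<dots> \<le> norm (cesaro K (x - p)) + norm (cesaro K p - p) + norm (x - p)"
      by (intro order_trans[OF norm_triangle_ineq4] add_mono norm_triangle_ineq order_refl)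
    finally show ?thesis
      using norm_cesaro[of K "x - p"] M[of K] p(2) that by auto
  qed
  then show "\<exists>M. \<forall>K\<ge>M. norm (cesaro K x - x) < e" by blast
qed

text \<open>Only the diagonal terms of the Cesaro mean remain, so it is constant for
  \<open>K > 0\<close> while converging to \<open>x\<close>.\<close>

lemma eq_spectral_0:
  assumes "\<And>d. d \<noteq> 0 \<Longrightarrow> spectral d x = 0"
  shows "x = spectral 0 x"
proof -
  have "cesaro K x = spectral 0 x" if "K > 0" for K
  proof -
    have "(\<Sum>i<K. \<Sum>l<K. spectral (int l - int i) x) = (\<Sum>i<K. \<Sum>l<K. if l = i then spectral 0 x else 0)"
      using assms by (intro sum.cong refl) auto
    then show ?thesis using that by (simp add: cesaro_def sum_constant_scaleR del: sum_constant)
  qed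
  then have "(\<lambda>K. cesaro K x) \<longlonglongrightarrow> spectral 0 x"
    by (intro tendsto_eventually eventually_mono[OF eventually_gt_at_top[of 0]])
  then show ?thesis by (rule LIMSEQ_unique[OF cesaro_tendsto])
qed

text \<open>The finite averages lie in \<open>A\<close>, where they commute with their adjoints;
  only this relation is passed to the limit, which may leave \<open>A\<close>.\<close>

lemma spectral_normal:
  assumes A: "star_subalg sm st A" "abelian_set A" "T_invariant \<omega> A" and x: "x \<in> A"
  shows "spectral d x * st (spectral d x) = st (spectral d x) * spectral d x"
proof -
  have scal: "scal c * y \<in> A" if "y \<in> A" for c y
    using A(1) that by (simp add: star_subalg_def flip: sm_conv_scal)
  have rot: "\<omega> (unit_root N j) x \<in> A" for N j
    using A(3) x norm_unit_root[of N j] by (simp add: T_invariant_def image_subset_iff)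
  have sum: "sum f I \<in> A" if "\<And>i. i \<in> I \<Longrightarrow> f i \<in> A" for f :: "nat \<Rightarrow> 'a" and I
    using that A(1) by (induction I rule: infinite_finite_induct) (simp_all add: star_subalg_def)
  have f: "fourier d N x \<in> A" for N
    unfolding fourier_def rot_avg_def scaleR_conv_scal by (intro scal sum rot)
  then have "st (fourier d N x) \<in> A" for N
    using A(1) by (simp add: star_subalg_def)
  then have comm: "fourier d N x * st (fourier d N x) = st (fourier d N x) * fourier d N x" for N
    using A(2) f unfolding abelian_set_def by blast
  have "(\<lambda>N. fourier d N x * st (fourier d N x)) \<longlonglongrightarrow> spectral d x * st (spectral d x)"
    by (intro tendsto_mult tendsto_st fourier_tendsto_spectral)
  moreover have "(\<lambda>N. st (fourier d N x) * fourier d N x) \<longlonglongrightarrow> st (spectral d x) * spectral d x"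
    by (intro tendsto_mult tendsto_st fourier_tendsto_spectral)
  ultimately show ?thesis unfolding comm by (rule LIMSEQ_unique)
qed

lemma abelian_T_inv_subset_fixed:
  assumes "abelian_T_inv_subalg sm st \<omega> A"
  shows "A \<subseteq> fixed_alg \<omega>"
proof
  fix x assume "x \<in> A"
  then have "spectral d x = 0" if "d \<noteq> 0" for d
    using assms spectral_normal normal_homogeneous_eq_0[OF spectral_in_cgrade that]
    unfolding abelian_T_inv_subalg_def by blast
  then have "x = spectral 0 x" by (rule eq_spectral_0)
  then have "x \<in> cgrade 0" by (metis spectral_in_cgrade)
  then show "x \<in> fixed_alg \<omega>"
    by (simp add: fixed_alg_def omega_cgrade_0)
qed

end

theorem theorem4p2:
  fixes sm :: "complex \<Rightarrow> 'a::{real_normed_algebra_1,banach} \<Rightarrow> 'a"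
    and st :: "'a \<Rightarrow> 'a" and n :: nat and s :: "nat \<Rightarrow> 'a"
    and \<omega> :: "complex \<Rightarrow> 'a \<Rightarrow> 'a" and A :: "'a set"
  assumes "n \<ge> 2"
    and "is_cuntz sm st n s"
    and "std_circle_action sm st n s \<omega>"
    and "maximal_abelian_T_inv sm st \<omega> A"
  shows "A \<subseteq> fixed_alg \<omega>"
proof -
  interpret cuntz_circle sm st n s \<omega>
    using assms by unfold_locales (auto simp: is_cuntz_def)
  show ?thesis
    using assms(4) by (intro abelian_T_inv_subset_fixed) (simp add: maximal_abelian_T_inv_def)
qed

end
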